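(* Let $A_2\in\mathbf{C}^{n\times n}$, $B_2\in\mathbf{C}^{n\times m}$, and let $Q\in\mathbf{C}^{n\times n}$, $R\in\mathbf{C}^{m\times m}$ be positive definite (Hermitian). Consider the antilinear system $$x(k+1)=A_2^{\#}x^{\#}(k)+B_2^{\#}u^{\#}(k),\qquad x(0)=x_0\in\mathbf{C}^n,$$ and the cost $J(u)=\sum_{k=0}^{\infty}\left(x^{\mathrm H}(k)Qx(k)+u^{\mathrm H}(k)Ru(k)\right)$. Then the following three statements are equivalent: 1. The LQR problem associated with this antilinear system has a solution. 2. The antilinear system is stabilizable, namely, $$\mathrm{rank}\begin{bmatrix}\lambda I_n-A_2A_2^{\#}&B_2&A_2B_2^{\#}\end{bmatrix}=n\quad\text{for all }\lambda\in\mathbf{C}\text{ with }|\lambda|\ge 1.$$ 3. There is a unique positive definite solution $P_A>0$ to the anti-Riccati equation $$-Q=A_2^{\mathrm H}P_A^{\#}A_2-A_2^{\mathrm H}P_A^{\#}B_2\left(R+B_2^{\mathrm H}P_A^{\#}B_2\right)^{-1}B_2^{\mathrm H}P_A^{\#}A_2-P_A.$$ In this case, the unique positive definite bimatrix solution $\{P_1,P_2\}$ of the bimatrix Riccati equation $$-\{Q,0\}=\{0,A_2\}^{\mathrm H}\{P_1,P_2\}\{0,A_2\}-\{P_1,P_2\}-\{0,A_2\}^{\mathrm H}\{P_1,P_2\}\{0,B_2\}\{S_1,S_2\}^{-1}\{0,B_2\}^{\mathrm H}\{P_1,P_2\}\{0,A_2\},$$ with $\{S_1,S_2\}=\{R,0\}+\{0,B_2\}^{\mathrm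 H}\{P_1,P_2\}\{0,B_2\}$, and the unique positive definite solution $P_A$ of the anti-Riccati equation are related by $$\{P_1,P_2\}=\{P_A,0\}.$$ Moreover, the optimal controller is the normal state feedback $u(k)=K_1^{\ast}x(k)$ with $$K_1^{\ast}=-\left(R+B_2^{\mathrm H}P_A^{\#}B_2\right)^{-1}B_2^{\mathrm H}P_A^{\#}A_2,$$ the closed-loop system is asymptotically stable, and the optimal value of $J(u)$ is $J_{\min}(u)=x_0^{\mathrm H}P_Ax_0$.
   Context: For a complex matrix $M$, $M^{\#}$, $M^{\mathrm T}$, $M^{\mathrm H}$ denote its (entrywise) conjugate, transpose and conjugate transpose. Positive definite matrices are Hermitian. LQR problem: find a control sequence $u^{\ast}$, $u(k)\in\mathbf{C}^m$, minimizing $J(u)$ along the trajectories of the system; the LQR problem is solvable (has a solution) if, for every initial condition $x_0\in\mathbf{C}^n$, the minimal value $J_{\min}(u^{\ast})$ is finite. Stabilizability: the antilinear system is stabilizable if there exist $K_1,K_2\in\mathbf{C}^{m\times n}$ such that the feedback $u(k)=K_1x(k)+K_2^{\#}x^{\#}(k)$ makes the closed-loop system asymptotically stable. (It is a known fact, recalled by the paper, that this is equivalent to the rank condition displayed in item 2.) Bimatrices. For $M_1,M_2\in\mathbf{C}^{p\times q}$ the bimatrix $\{M_1,M_2\}$ is the real-linear map $\mathbf{C}^q\to\mathbf{C}^p$, $\{M_1,M_2\}x=M_1x+M_2^{\#}x^{\#}$. Addition is componentwise. The product is composition: $\{M_1,M_2\}\{N_1,N_2\}=\{M_1N_1+M_2^{\#}N_2,\;M_2N_1+M_1^{\#}N_2\}$.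 The identity is $\{I,0\}$, and the inverse is taken with respect to this product. The conjugate transpose is $\{M_1,M_2\}^{\mathrm H}=\{M_1^{\mathrm H},M_2^{\mathrm T}\}$. A bimatrix $\{P_1,P_2\}$ with $P_i\in\mathbf{C}^{n\times n}$ is positive definite if $\{P_1,P_2\}^{\mathrm H}=\{P_1,P_2\}$ and $\operatorname{Re}(x^{\mathrm H}\{P_1,P_2\}x)>0$ for all nonzero $x\in\mathbf{C}^n$ (equivalently, $\begin{bmatrix}P_1&P_2^{\#}\\P_2&P_1^{\#}\end{bmatrix}$ is positive definite). *)

theory Defs
  imports "HOL-Analysis.Analysis"
begin

section \<open>Complex matrices\<close>

definition conj_vec :: "complex^'n \<Rightarrow> complex^'n"
  where "conj_vec x = (\<chi> i. cnj (x $ i))"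

abbreviation conj_mat :: "complex^'n^'m \<Rightarrow> complex^'n^'m"  ("(_\<^sup>#)" [1000] 999)
  where "M\<^sup># \<equiv> map_matrix cnj M"

definition adj_mat :: "complex^'n^'m \<Rightarrow> complex^'m^'n"  ("(_\<^sup>H)" [1000] 999)
  where "M\<^sup>H = transpose (M\<^sup>#)"

text \<open>\<open>cdot x y\<close> is \<open>x\<^sup>H y\<close>, conjugate-linear in the first argument.\<close>

definition cdot :: "complex^'n \<Rightarrow> complex^'n \<Rightarrow> complex"
  where "cdot x y = (\<Sum>i\<in>UNIV. cnj (x $ i) * y $ i)"

definition pos_def_mat :: "complex^'n^'n \<Rightarrow> bool"
  where "pos_def_mat P \<longleftrightarrow> P\<^sup>H = P \<and> (\<forall>x. x \<noteq> 0 \<longrightarrow> 0 < Re (cdot x (P *v x)))"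

text \<open>The block row \<open>[M\<^sub>1  M\<^sub>2  M\<^sub>3]\<close>; its columns are indexed by the sum type.\<close>

definition block_row3 ::
    "complex^'a^'n \<Rightarrow> complex^'b^'n \<Rightarrow> complex^'c^'n \<Rightarrow> complex^('a + 'b + 'c)^'n"
  where "block_row3 M1 M2 M3 =
    (\<chi> i j. case j of Inl a \<Rightarrow> M1 $ i $ a | Inr (Inl b) \<Rightarrow> M2 $ i $ b | Inr (Inr c) \<Rightarrow> M3 $ i $ c)"


section \<open>Bimatrices\<close>

text \<open>The pair \<open>(M\<^sub>1, M\<^sub>2)\<close> stands for the bimatrix \<open>{M\<^sub>1, M\<^sub>2}\<close>.  Addition, subtraction and
  negation are the componentwise operations that the library provides on pairs.\<close>

type_synonym ('q, 'p) bimatrix = "(complex^'q^'p) \<times> (complex^'q^'p)"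

definition bimat_apply :: "('q::finite, 'p::finite) bimatrix \<Rightarrow> complex^'q \<Rightarrow> complex^'p"
  where "bimat_apply M x = fst M *v x + (snd M)\<^sup># *v conj_vec x"

definition bimat_mult ::
    "('q::finite, 'p::finite) bimatrix \<Rightarrow> ('r::finite, 'q) bimatrix \<Rightarrow> ('r, 'p) bimatrix"
    (infixl "\<odot>" 70)
  where "M \<odot> N =
    (fst M ** fst N + (snd M)\<^sup># ** snd N, snd M ** fst N + (fst M)\<^sup># ** snd N)"

definition bimat_one :: "('n::finite, 'n) bimatrix"
  where "bimat_one = (mat 1, 0)"

text \<open>As for \<open>matrix_inv\<close>, the value is unspecified when there is no inverse.\<close>

definition bimat_inv :: "('n::finite, 'n) bimatrix \<Rightarrow> ('n, 'n) bimatrix"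
  where "bimat_inv M = (SOME N. M \<odot> N = bimat_one \<and> N \<odot> M = bimat_one)"

definition bimat_adj :: "('q::finite, 'p::finite) bimatrix \<Rightarrow> ('p, 'q) bimatrix"
  where "bimat_adj M = ((fst M)\<^sup>H, transpose (snd M))"

definition pos_def_bimat :: "('n::finite, 'n) bimatrix \<Rightarrow> bool"
  where "pos_def_bimat P \<longleftrightarrow>
    bimat_adj P = P \<and> (\<forall>x. x \<noteq> 0 \<longrightarrow> 0 < Re (cdot x (bimat_apply P x)))"

lemma conj_mat_vec: "conj_vec (M *v x) = M\<^sup># *v conj_vec x"
  by (simp add: vec_eq_iff conj_vec_def matrix_vector_mult_def)

lemma conj_vec_add: "conj_vec (x + y) = conj_vec x + conj_vec y"
  by (simp add: vec_eq_iff conj_vec_def)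

lemma conj_mat_simps:
  shows conj_mat_mult: "(A ** B)\<^sup># = A\<^sup># ** B\<^sup>#"
    and conj_mat_add: "(A + A')\<^sup># = A\<^sup># + A'\<^sup>#"
    and conj_mat_conj: "(A\<^sup>#)\<^sup># = A"
    and conj_vec_conj: "conj_vec (conj_vec x) = x"
  by (simp_all add: vec_eq_iff matrix_matrix_mult_def conj_vec_def)

lemma bimat_apply_mult: "bimat_apply (M \<odot> N) x = bimat_apply M (bimat_apply N x)"
  by (simp add: bimat_apply_def bimat_mult_def conj_mat_simps conj_mat_vec conj_vec_add
      matrix_vector_mul_assoc matrix_vector_mult_add_rdistrib matrix_vector_right_distrib)

lemma conj_mat_zero: "0\<^sup># = 0"
  by (simp add: vec_eq_iff)

lemma bimat_apply_one: "bimat_apply bimat_one x = x"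
  by (simp add: bimat_apply_def bimat_one_def conj_mat_zero)


section \<open>The antilinear system and its LQR problem\<close>

definition antilin_step :: "complex^'n^'n \<Rightarrow> complex^'m^'n \<Rightarrow> complex^'n \<Rightarrow> complex^'m \<Rightarrow> complex^'n"
  where "antilin_step A B x u = A\<^sup># *v conj_vec x + B\<^sup># *v conj_vec u"

primrec trajectory ::
    "complex^'n^'n \<Rightarrow> complex^'m^'n \<Rightarrow> complex^'n \<Rightarrow> (nat \<Rightarrow> complex^'m) \<Rightarrow> nat \<Rightarrow> complex^'n"
  where
    "trajectory A B x0 u 0 = x0"
  | "trajectory A B x0 u (Suc k) = antilin_step A B (trajectory A B x0 u k) (u k)"

text \<open>Both quadratic forms are real and nonnegative for positive definite \<open>Q\<close> and \<open>R\<close>; the sum is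
  taken in the extended reals, so that a divergent cost is \<open>\<infinity>\<close>.\<close>

definition lqr_cost ::
    "complex^'n^'n \<Rightarrow> complex^'m^'n \<Rightarrow> complex^'n^'n \<Rightarrow> complex^'m^'m \<Rightarrow>
     complex^'n \<Rightarrow> (nat \<Rightarrow> complex^'m) \<Rightarrow> ereal"
  where "lqr_cost A B Q R x0 u =
    (\<Sum>k. ereal (Re (cdot (trajectory A B x0 u k) (Q *v trajectory A B x0 u k)
                     + cdot (u k) (R *v u k))))"

definition lqr_optimal ::
    "complex^'n^'n \<Rightarrow> complex^'m^'n \<Rightarrow> complex^'n^'n \<Rightarrow> complex^'m^'m \<Rightarrow>
     complex^'n \<Rightarrow> (nat \<Rightarrow> complex^'m) \<Rightarrow> bool"
  where "lqr_optimal A B Q R x0 u \<longleftrightarrow> (\<forall>v. lqr_cost A B Q R x0 u \<le> lqr_cost A B Q R x0 v)"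

definition lqr_solvable ::
    "complex^'n^'n \<Rightarrow> complex^'m^'n \<Rightarrow> complex^'n^'n \<Rightarrow> complex^'m^'m \<Rightarrow> bool"
  where "lqr_solvable A B Q R \<longleftrightarrow>
    (\<forall>x0. \<exists>u. lqr_optimal A B Q R x0 u \<and> \<bar>lqr_cost A B Q R x0 u\<bar> \<noteq> \<infinity>)"

text \<open>Lyapunov stability and attractivity of the origin for \<open>x(k+1) = f (x(k))\<close>.  Attractivity is
  global, which for real-linear \<open>f\<close> is the same as local attractivity.\<close>

definition asymptotically_stable :: "('a::real_normed_vector \<Rightarrow> 'a) \<Rightarrow> bool"
  where "asymptotically_stable f \<longleftrightarrow>
    (\<forall>\<epsilon>>0. \<exists>\<delta>>0. \<forall>x. norm x < \<delta> \<longrightarrow> (\<forall>k. norm ((f ^^ k) x) < \<epsilon>)) \<and>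
    (\<forall>x. (\<lambda>k. (f ^^ k) x) \<longlonglongrightarrow> 0)"

definition stabilizable :: "complex^'n^'n \<Rightarrow> complex^'m^'n \<Rightarrow> bool"
  where "stabilizable A B \<longleftrightarrow>
    (\<exists>K1 K2. asymptotically_stable (\<lambda>x. antilin_step A B x (bimat_apply (K1, K2) x)))"


section \<open>Riccati equations\<close>

definition anti_riccati ::
    "complex^'n^'n \<Rightarrow> complex^'m^'n \<Rightarrow> complex^'n^'n \<Rightarrow> complex^'m^'m \<Rightarrow> complex^'n^'n \<Rightarrow> bool"
  where "anti_riccati A B Q R P \<longleftrightarrow>
    - Q = A\<^sup>H ** P\<^sup># ** A
          - A\<^sup>H ** P\<^sup># ** B ** matrix_inv (R + B\<^sup>H ** P\<^sup># ** B) ** B\<^sup>H ** P\<^sup># ** A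
          - P"

definition bimat_riccati ::
    "complex^'n^'n \<Rightarrow> complex^'m^'n \<Rightarrow> complex^'n^'n \<Rightarrow> complex^'m^'m \<Rightarrow>
     ('n, 'n) bimatrix \<Rightarrow> bool"
  where "bimat_riccati A B Q R P \<longleftrightarrow>
    (let S = (R, 0) + bimat_adj (0, B) \<odot> P \<odot> (0, B) in
      - (Q, 0) = bimat_adj (0, A) \<odot> P \<odot> (0, A) - P
        - bimat_adj (0, A) \<odot> P \<odot> (0, B) \<odot> bimat_inv S \<odot> bimat_adj (0, B) \<odot> P \<odot> (0, A))"

definition anti_gain ::
    "complex^'n^'n \<Rightarrow> complex^'m^'n \<Rightarrow> complex^'m^'m \<Rightarrow> complex^'n^'n \<Rightarrow> complex^'n^'m"
  where "anti_gain A B R P = - (matrix_inv (R + B\<^sup>H ** P\<^sup># ** B) ** B\<^sup>H ** P\<^sup># ** A)"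

end

theory Submission
  imports Defs "HOL-Computational_Algebra.Fundamental_Theorem_Algebra"
begin

text \<open>
  A positive definite solution of either Riccati equation completes the square in Bellman's equation,
  so it determines the optimal cost; this gives uniqueness, optimality and, with the cost as a Lyapunov
  function, stability.  A mode \<open>w\<close> that violates the rank condition satisfies
  \<open>w\<^sup>T conj (x(k+2)) = \<lambda> w\<^sup>T conj (x k)\<close> whatever the input is, so no trajectory from \<open>w\<close> tends to \<open>0\<close>.
  Conversely, the rank condition bounds the increasing sequence of finite-horizon costs (the Riccati
  iteration from \<open>0\<close>), whose limit solves the anti-Riccati equation.
\<close>

subsection \<open>Real and complex inner products\<close>

text \<open>Conjugation makes the dynamics only real-linear: a single step has no complex spectrum,
  and an optimal gain could a priori have a conjugate-linear part. Two devices answer this.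
  Quadratic forms are taken with the real inner product \<open>\<bullet>\<close>, the real part of
  \<open>cdot\<close>, for which matrices and bimatrices are alike real-linear maps with adjoints.
  One completion of the square then serves both Riccati equations, and since both forms equal the
  same infimum of costs, the bimatrix solution must be \<open>(P, 0)\<close>. Spectral arguments are
  made for two steps, whose state matrix \<open>A\<^sup># ** A\<close> acts complex-linearly; this
  is why the rank condition contains \<open>A ** A\<^sup>#\<close> and
  \<open>A ** B\<^sup>#\<close>. The harder implication leads from the rank condition to a Riccati
  solution. No stabilizing feedback is built in advance: the states of bounded finite-horizon cost
  are shown to be all states, and stability is read off from the solution at the end.\<close>

lemma Re_cdot: "Re (cdot x y) = x \<bullet> y"
  by (simp add: cdot_def inner_vec_def inner_complex_def)

lemma inner_conj_vec: "conj_vec x \<bullet> conj_vec y = x \<bullet> y"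
  by (simp add: conj_vec_def inner_vec_def inner_complex_def)

lemma linear_conj_vec: "linear conj_vec"
  by (rule linearI) (simp_all add: conj_vec_def vec_eq_iff complex_eq_iff)

lemma scaleR_matrix_vector_mult:
  "M *v (r *\<^sub>R x) = r *\<^sub>R (M *v x)" for M :: "complex^'n^'m"
  by (simp add: vec_eq_iff matrix_vector_mult_def scaleR_sum_right)

lemma linear_complex_matrix: "linear ((*v) M)" for M :: "complex^'n^'m"
  by (rule linearI) (simp_all add: matrix_vector_right_distrib scaleR_matrix_vector_mult)

lemma adj_mat_conj: "(M\<^sup>#)\<^sup>H = (M\<^sup>H)\<^sup>#"
  by (simp add: adj_mat_def vec_eq_iff transpose_def)

lemma adj_mat_adj: "(M\<^sup>H)\<^sup>H = M"
  by (simp add: adj_mat_def vec_eq_iff transpose_def)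

lemma cdot_adj: "cdot (M *v x) y = cdot x (M\<^sup>H *v y)"
  by (simp add: cdot_def adj_mat_def matrix_vector_mult_def transpose_def sum_distrib_left
      sum_distrib_right mult.assoc mult.left_commute)
    (subst sum.swap, simp add: mult_ac)

lemma adj_mat_inner: "(M\<^sup>H *v x) \<bullet> y = x \<bullet> (M *v y)"
  by (metis Re_cdot cdot_adj adj_mat_adj)

lemma adj_mat_add: "(M + N)\<^sup>H = M\<^sup>H + N\<^sup>H"
  by (simp add: adj_mat_def vec_eq_iff transpose_def)

lemma adj_mat_diff: "(M - N)\<^sup>H = M\<^sup>H - N\<^sup>H"
  by (simp add: adj_mat_def vec_eq_iff transpose_def)

lemma adj_mat_mult: "(M ** N)\<^sup>H = N\<^sup>H ** M\<^sup>H"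
  by (simp add: adj_mat_def vec_eq_iff transpose_def matrix_matrix_mult_def mult.commute)

lemma adj_mat_inner_right: "y \<bullet> (M\<^sup>H *v x) = (M *v y) \<bullet> x"
  by (metis adj_mat_inner inner_commute)

lemma matrix_vector_mult_minus: "(- M) *v x = - (M *v x)" for M :: "complex^'n^'m"
  by (simp add: vec_eq_iff matrix_vector_mult_def sum_negf)

lemma hermitian_inner: "P\<^sup>H = P \<Longrightarrow> (P *v x) \<bullet> y = x \<bullet> (P *v y)"
  by (metis adj_mat_inner)

lemma matrix_vector_mult_axis: "(M *v axis j c) $ i = M $ i $ j * c" for M :: "complex^'n^'m"
  by (simp add: matrix_vector_mult_def axis_def if_distrib[of "\<lambda>x. _ * x"] cong: if_cong)

lemma conj_mat_transpose: "(transpose M)\<^sup># = M\<^sup>H"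
  by (simp add: vec_eq_iff adj_mat_def transpose_def)

lemma conj_mat_adj: "(M\<^sup>H)\<^sup># = transpose M"
  by (simp add: vec_eq_iff adj_mat_def transpose_def)

lemma adj_mat_zero: "0\<^sup>H = 0"
  by (simp add: vec_eq_iff adj_mat_def transpose_def)

lemma of_real_scale: "complex_of_real r *s x = r *\<^sub>R x"
  by (simp add: vec_eq_iff complex_eq_iff)

lemma inner_scale_scale: "(c *s x) \<bullet> (c *s y) = (cmod c)\<^sup>2 * (x \<bullet> y)" for x :: "complex^'n"
  unfolding cmod_power2
  by (simp add: inner_vec_def inner_complex_def sum_distrib_left power2_eq_square algebra_simps)

lemma inner_scale_left: "(c *s x) \<bullet> y = x \<bullet> (cnj c *s y)" for x :: "complex^'n"
  by (simp add: inner_vec_def inner_complex_def algebra_simps)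

section \<open>Symmetric forms and real-linear maps\<close>

lemma sym_form_polarization:
  assumes "linear f" "\<And>x y. f x \<bullet> y = x \<bullet> f y"
  shows "x \<bullet> f y = ((x + y) \<bullet> f (x + y) - x \<bullet> f x - y \<bullet> f y) / 2"
  using assms(2)[of x y] by (simp add: linear_add[OF assms(1)] inner_add inner_commute)

text \<open>Polarization recovers a symmetric form from its diagonal. This turns equality of optimal
  costs into equality of Riccati solutions.\<close>

lemma sym_form_unique:
  assumes "linear f" "\<And>x y. f x \<bullet> y = x \<bullet> f y" "linear g" "\<And>x y. g x \<bullet> y = x \<bullet> g y"
    and "\<And>x. x \<bullet> f x = x \<bullet> g x"
  shows "f y = g y"
proof -
  have "x \<bullet> f y = x \<bullet> g y" for x
    using sym_form_polarization[OF assms(1,2), of x y] sym_form_polarization[OF assms(3,4), of x y] assms(5)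
    by simp
  then show ?thesis by (metis vector_eq_ldot)
qed

text \<open>The minimum of the form on the compact unit sphere serves as \<open>c\<close>.\<close>

lemma pos_def_form_lower:
  fixes f :: "'a::euclidean_space \<Rightarrow> 'a"
  assumes "linear f" "\<And>x. x \<noteq> 0 \<Longrightarrow> 0 < x \<bullet> f x"
  obtains c where "c > 0" "\<And>x. c * (norm x)\<^sup>2 \<le> x \<bullet> f x"
proof (cases "\<exists>x::'a. norm x = 1")
  case True
  then have ne: "sphere (0::'a) 1 \<noteq> {}" by (auto simp: sphere_def dist_norm)
  have "continuous_on (sphere 0 1) (\<lambda>x. x \<bullet> f x)"
    by (intro continuous_intros linear_continuous_on linear_conv_bounded_linear[THEN iffD1] assms)
  from continuous_attains_inf[OF compact_sphere ne this]
  obtain z where z: "norm z = 1" "\<And>y. norm y = 1 \<Longrightarrow> z \<bullet> f z \<le> y \<bullet> f y"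
    by auto
  show thesis
  proof (rule that)
    show "0 < z \<bullet> f z" using z(1) by (intro assms(2)) auto
    show "(z \<bullet> f z) * (norm x)\<^sup>2 \<le> x \<bullet> f x" for x
    proof (cases "x = 0")
      case False
      let ?y = "(1 / norm x) *\<^sub>R x"
      have "z \<bullet> f z \<le> ?y \<bullet> f ?y" using False by (intro z(2)) simp
      also have "\<dots> = (x \<bullet> f x) / (norm x)\<^sup>2"
        by (simp add: linear_cmul[OF assms(1)] power2_eq_square)
      finally show ?thesis using False by (simp add: field_simps)
    qed simp
  qed
next
  case False
  then have "x = 0" for x :: 'a using norm_sgn[of x] by (auto split: if_splits)
  then have "1 * (norm x)\<^sup>2 \<le> x \<bullet> f x" for x :: 'a
    using linear_0[OF assms(1)] by (metis inner_zero_left mult_zero_right norm_zero order_refl power_zero_numeral)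
  then show thesis using that[of 1] by simp
qed

lemma form_upper:
  fixes f :: "'a::euclidean_space \<Rightarrow> 'a"
  assumes "linear f"
  obtains b where "b > 0" "\<And>x. x \<bullet> f x \<le> b * (norm x)\<^sup>2"
proof -
  obtain b where b: "b > 0" "\<And>x. norm (f x) \<le> b * norm x" using linear_bounded_pos[OF assms] by blast
  show thesis
  proof (rule that[OF b(1)])
    fix x
    have "x \<bullet> f x \<le> norm x * norm (f x)" by (rule norm_cauchy_schwarz)
    also have "\<dots> \<le> norm x * (b * norm x)" by (intro mult_left_mono b) simp
    finally show "x \<bullet> f x \<le> b * (norm x)\<^sup>2" by (simp add: power2_eq_square mult_ac)
  qed
qed

text \<open>The hypothesis on \<open>k\<close> is the first-order condition for minimizing the left
  side over \<open>u\<close>, so only \<open>u - k\<close> survives in the quadratic remainder and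
  the other summand is the minimum. Stating it for real-linear maps with real adjoint
  \<open>G'\<close> covers both matrices and bimatrices.\<close>

lemma completed_square:
  fixes a :: "'a::real_inner" and u :: "'b::real_inner"
  assumes "linear W" "\<And>x y. W x \<bullet> y = x \<bullet> W y" "linear R" "\<And>x y. R x \<bullet> y = x \<bullet> R y"
    and "linear G" "\<And>x u. G' x \<bullet> u = x \<bullet> G u" "linear G'"
    and k: "R k + G' (W (G k)) = - G' (W a)"
  shows "u \<bullet> R u + (a + G u) \<bullet> W (a + G u)
    = a \<bullet> W (a + G k) + (u - k) \<bullet> (R (u - k) + G' (W (G (u - k))))"
proof -
  have 1: "u \<bullet> R k + u \<bullet> G' (W (G k)) = - (u \<bullet> G' (W a))" for u
    using arg_cong[OF k, of "\<lambda>z. u \<bullet> z"] by (simp add: inner_add)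
  have adj: "u \<bullet> G' x = G u \<bullet> x" for u x using assms(6)[of x u] by (simp add: inner_commute)
  have 2: "x \<bullet> W y = y \<bullet> W x" for x y using assms(2)[of y x] by (simp add: inner_commute)
  have 3: "x \<bullet> R y = y \<bullet> R x" for x y using assms(4)[of y x] by (simp add: inner_commute)
  show ?thesis using 1[of u] 1[of k] 2[of a "G k"] 2[of a "G u"] 2[of "G k" "G u"] 3[of u k]
    by (simp add: linear_add[OF assms(1)] linear_diff[OF assms(1)] linear_diff[OF assms(3)]
       linear_diff[OF assms(5)] linear_diff[OF assms(7)] adj inner_add inner_diff)
qed

lemma complement_image:
  fixes F :: "'a::euclidean_space \<Rightarrow> 'a"
  assumes "linear F" "subspace X" and FX: "\<And>x. F x \<in> X \<Longrightarrow> x \<in> X"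
  shows "\<exists>x z. z \<in> X \<and> y = F x + z" and "x \<in> X \<Longrightarrow> F x \<in> X"
proof -
  define Y where "Y = {y. \<forall>x\<in>X. orthogonal x y}"
  have Y: "subspace Y" unfolding Y_def by (rule subspace_orthogonal_to_vectors)
  have dY: "dim Y + dim X = DIM('a)"
    using dim_subspace_orthogonal_to_vectors[OF assms(2) subspace_UNIV] by (simp add: Y_def)
  have XY: "z = 0" if "z \<in> X" "z \<in> Y" for z
    using that by (auto simp: Y_def orthogonal_def)
  have inj: "inj_on F Y"
    using FX XY assms(2) by (auto simp: linear_inj_on_iff_eq_0[OF assms(1) Y] subspace_0)
  have dFY: "dim (F ` Y) = dim Y"
    using dim_image_eq[OF assms(1), of Y] inj Y by (simp add: span_eq_iff[THEN iffD2])
  have sFY: "subspace (F ` Y)" using assms(1) Y by (rule linear_subspace_image)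
  have "F ` Y \<inter> X = {0}"
  proof
    show "F ` Y \<inter> X \<subseteq> {0}" using FX XY linear_0[OF assms(1)] by blast
    show "{0} \<subseteq> F ` Y \<inter> X" using subspace_0[OF sFY] subspace_0[OF assms(2)] by simp
  qed
  then have "dim {x + y |x y. x \<in> F ` Y \<and> y \<in> X} = DIM('a)"
    using dim_sums_Int[OF sFY assms(2)] dFY dY by (simp add: dim_eq_0)
  then have full: "{x + y |x y. x \<in> F ` Y \<and> y \<in> X} = UNIV"
    using subspace_sums[OF sFY assms(2)] by (simp add: dim_eq_full span_eq_iff[THEN iffD2])
  then show "\<exists>x z. z \<in> X \<and> y = F x + z" by blast
  show "F x \<in> X" if "x \<in> X"
  proof -
    obtain x' z where x': "x' \<in> Y" "z \<in> X" "F x = F x' + z" using full by blast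
    then have "F (x - x') \<in> X" by (simp add: linear_diff[OF assms(1)])
    then have "x' \<in> X" using subspace_diff[OF assms(2) that FX] by fastforce
    then have "x' = 0" using XY x' by blast
    then show ?thesis using x' linear_0[OF assms(1)] by simp
  qed
qed

subsection \<open>Optimal feedback from the Bellman equation\<close>

lemma tendsto_zero_squeeze:
  fixes f g :: "nat \<Rightarrow> real"
  assumes "g \<longlonglongrightarrow> 0" "\<And>k. 0 \<le> f k" "\<And>k. f k \<le> g k"
  shows "f \<longlonglongrightarrow> 0"
  by (rule tendsto_sandwich[OF _ _ tendsto_const assms(1)]) (simp_all add: assms)

lemma asymptotically_stableI:
  fixes f :: "'a::real_normed_vector \<Rightarrow> 'a"
  assumes "0 \<le> \<rho>" "\<rho> < 1" "0 < D"
    and bound: "\<And>k x. (norm ((f ^^ k) x))\<^sup>2 \<le> D * \<rho> ^ k * (norm x)\<^sup>2"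
  shows "asymptotically_stable f"
  unfolding asymptotically_stable_def
proof (intro conjI allI impI)
  fix \<epsilon> :: real assume \<epsilon>: "\<epsilon> > 0"
  show "\<exists>\<delta>>0. \<forall>x. norm x < \<delta> \<longrightarrow> (\<forall>k. norm ((f ^^ k) x) < \<epsilon>)"
  proof (intro exI[of _ "\<epsilon> / sqrt D"] conjI allI impI)
    show "0 < \<epsilon> / sqrt D" using \<epsilon> assms by simp
    fix x :: 'a and k assume "norm x < \<epsilon> / sqrt D"
    then have "(norm x)\<^sup>2 < (\<epsilon> / sqrt D)\<^sup>2" by (intro power_strict_mono) auto
    then have x: "D * (norm x)\<^sup>2 < \<epsilon>\<^sup>2" using assms by (simp add: power_divide field_simps)
    have "D * \<rho> ^ k * (norm x)\<^sup>2 \<le> D * 1 * (norm x)\<^sup>2"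
      using assms by (intro mult_right_mono mult_left_mono power_le_one) auto
    then have "(norm ((f ^^ k) x))\<^sup>2 < \<epsilon>\<^sup>2" using bound[of k x] x by simp
    then show "norm ((f ^^ k) x) < \<epsilon>" using \<epsilon> by (simp add: power_less_imp_less_base)
  qed
next
  fix x :: 'a
  have "(\<lambda>k. D * \<rho> ^ k * (norm x)\<^sup>2) \<longlonglongrightarrow> D * 0 * (norm x)\<^sup>2"
    using assms by (intro tendsto_intros LIMSEQ_realpow_zero) auto
  then have "(\<lambda>k. (norm ((f ^^ k) x))\<^sup>2) \<longlonglongrightarrow> 0"
    by - (rule tendsto_zero_squeeze[of "\<lambda>k. D * \<rho> ^ k * (norm x)\<^sup>2"], simp_all add: bound)
  then have "(\<lambda>k. sqrt ((norm ((f ^^ k) x))\<^sup>2)) \<longlonglongrightarrow> sqrt 0" by (rule tendsto_real_sqrt)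
  then show "(\<lambda>k. (f ^^ k) x) \<longlonglongrightarrow> 0" by (simp add: tendsto_norm_zero_iff)
qed

lemma trajectory_feedback:
  assumes "\<And>k. u k = K (((\<lambda>x. antilin_step A B x (K x)) ^^ k) x0)"
  shows "trajectory A B x0 u k = ((\<lambda>x. antilin_step A B x (K x)) ^^ k) x0"
  by (induction k) (simp_all add: assms)

definition stage_cost where
  "stage_cost Q R x u = x \<bullet> (Q *v x) + u \<bullet> (R *v u)" for Q :: "complex^'n^'n" and R :: "complex^'m^'m"

lemma lqr_cost_stage:
  "lqr_cost A B Q R x0 u = (\<Sum>k. ereal (stage_cost Q R (trajectory A B x0 u k) (u k)))"
  by (simp add: lqr_cost_def stage_cost_def Re_cdot)

lemma pos_def_mat_bound:
  assumes "pos_def_mat Q"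
  obtains c where "c > 0" "\<And>x. c * (norm x)\<^sup>2 \<le> x \<bullet> (Q *v x)"
  using pos_def_form_lower[OF linear_complex_matrix, of Q] assms
  by (metis pos_def_mat_def Re_cdot)

lemma pos_def_mat_nonneg: "pos_def_mat Q \<Longrightarrow> 0 \<le> x \<bullet> (Q *v x)"
  by (cases "x = 0") (auto simp: pos_def_mat_def Re_cdot less_imp_le)

lemma stage_cost_nonneg:
  "pos_def_mat Q \<Longrightarrow> pos_def_mat R \<Longrightarrow> 0 \<le> stage_cost Q R x u"
  by (simp add: stage_cost_def pos_def_mat_nonneg)

text \<open>Coercivity of \<open>Q\<close> bounds the squared norm of the state by a multiple of the
  stage cost, and the terms of a convergent series tend to 0.\<close>

lemma lqr_cost_finiteD:
  assumes "pos_def_mat Q" "pos_def_mat R" "lqr_cost A B Q R x0 u \<noteq> \<infinity>"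
  shows "summable (\<lambda>k. stage_cost Q R (trajectory A B x0 u k) (u k))"
    and "trajectory A B x0 u \<longlonglongrightarrow> 0"
proof -
  let ?g = "\<lambda>k. stage_cost Q R (trajectory A B x0 u k) (u k)"
  show s: "summable ?g"
    using assms by (intro summable_ereal) (auto simp: stage_cost_nonneg lqr_cost_stage)
  obtain c where c: "c > 0" "\<And>x. c * (norm x)\<^sup>2 \<le> x \<bullet> (Q *v x)"
    using pos_def_mat_bound[OF assms(1)] by blast
  have g: "c * (norm (trajectory A B x0 u k))\<^sup>2 \<le> ?g k" for k
    using c(2)[of "trajectory A B x0 u k"] pos_def_mat_nonneg[OF assms(2), of "u k"]
    by (simp add: stage_cost_def)
  have "(\<lambda>k. ?g k / c) \<longlonglongrightarrow> 0 / c"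
    using c(1) by (intro tendsto_divide tendsto_const summable_LIMSEQ_zero s) auto
  moreover have "(norm (trajectory A B x0 u k))\<^sup>2 \<le> ?g k / c" for k
    using g[of k] c(1) by (simp only: pos_le_divide_eq mult.commute)
  ultimately have "(\<lambda>k. (norm (trajectory A B x0 u k))\<^sup>2) \<longlonglongrightarrow> 0"
    by - (rule tendsto_zero_squeeze[of "\<lambda>k. ?g k / c"], simp_all)
  then have "(\<lambda>k. sqrt ((norm (trajectory A B x0 u k))\<^sup>2)) \<longlonglongrightarrow> sqrt 0" by (rule tendsto_real_sqrt)
  then show "trajectory A B x0 u \<longlonglongrightarrow> 0" by (simp add: tendsto_norm_zero_iff)
qed

text \<open>A certificate of optimality: \<open>p\<close> is the candidate optimal cost,
  \<open>K\<close> the feedback, and \<open>s\<close> the penalty for deviating from it.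
  \<open>K\<close> is any map, not a matrix, so that the real-linear gain of the bimatrix equation
  fits as well.\<close>

locale value_function =
  fixes A :: "complex^'n^'n" and B :: "complex^'m^'n"
    and Q :: "complex^'n^'n" and R :: "complex^'m^'m"
    and p :: "complex^'n \<Rightarrow> real" and s :: "complex^'m \<Rightarrow> real"
    and K :: "complex^'n \<Rightarrow> complex^'m" and b :: real
  assumes Q: "pos_def_mat Q" and R: "pos_def_mat R"
    and bellman: "stage_cost Q R x u + p (antilin_step A B x u) = p x + s (u - K x)"
    and p_nonneg: "0 \<le> p x" and p_le: "p x \<le> b * (norm x)\<^sup>2"
    and s_zero: "s 0 = 0" and s_pos: "z \<noteq> 0 \<Longrightarrow> 0 < s z"
begin

lemma s_nonneg: "0 \<le> s z"
  using s_zero s_pos[of z] by (cases "z = 0") auto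

lemma closed_loop_decrease: "stage_cost Q R x (K x) + p (antilin_step A B x (K x)) = p x"
  using bellman[of x "K x"] s_zero by simp

lemma closed_loop_stable: "asymptotically_stable (\<lambda>x. antilin_step A B x (K x))"
proof -
  let ?f = "\<lambda>x. antilin_step A B x (K x)"
  obtain c where c: "c > 0" "\<And>x. c * (norm x)\<^sup>2 \<le> x \<bullet> (Q *v x)"
    using pos_def_mat_bound[OF Q] by blast
  have dec: "c * (norm x)\<^sup>2 + p (?f x) \<le> p x" for x
    using closed_loop_decrease[of x] c(2)[of x] pos_def_mat_nonneg[OF R, of "K x"]
    by (simp add: stage_cost_def)
  \<comment> \<open>The sign of \<open>b\<close> is unknown. Adding \<open>c\<close> gives
    \<open>0 < b'\<close> and \<open>c \<le> b'\<close>, which puts the contraction factor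
    \<open>1 - c / b'\<close> in \<open>[0, 1)\<close>.\<close>
  define b' where "b' = c + \<bar>b\<bar>"
  have b': "b' > 0" "c \<le> b'" using c(1) by (auto simp: b'_def)
  have p_le': "p x \<le> b' * (norm x)\<^sup>2" for x
  proof -
    have "b * (norm x)\<^sup>2 \<le> b' * (norm x)\<^sup>2" using c(1) by (intro mult_right_mono) (auto simp: b'_def)
    then show ?thesis using p_le[of x] by simp
  qed
  define \<rho> where "\<rho> = 1 - c / b'"
  have \<rho>: "0 \<le> \<rho>" "\<rho> < 1" using b' c(1) by (auto simp: \<rho>_def)
  have "p (?f x) \<le> \<rho> * p x" for x
  proof -
    have "c / b' * p x \<le> c / b' * (b' * (norm x)\<^sup>2)"
      using b' c(1) by (intro mult_left_mono p_le') auto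
    also have "\<dots> = c * (norm x)\<^sup>2" using b'(1) by simp
    finally show ?thesis using dec[of x] by (simp only: \<rho>_def left_diff_distrib mult_1_left)
  qed
  then have pk: "p ((?f ^^ k) x) \<le> \<rho> ^ k * p x" for k x
  proof (induction k)
    case (Suc k)
    have "p ((?f ^^ Suc k) x) \<le> \<rho> * p ((?f ^^ k) x)" using Suc.prems by simp
    also have "\<dots> \<le> \<rho> * (\<rho> ^ k * p x)" using Suc \<rho>(1) by (intro mult_left_mono) auto
    finally show ?case by simp
  qed simp
  show ?thesis
  proof (rule asymptotically_stableI[OF \<rho>])
    show "0 < b' / c" using b' c(1) by simp
    fix k x
    have "c * (norm ((?f ^^ k) x))\<^sup>2 \<le> p ((?f ^^ k) x)"
      using dec[of "(?f ^^ k) x"] p_nonneg[of "?f ((?f ^^ k) x)"] by simp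
    also have "\<dots> \<le> \<rho> ^ k * p x" by (rule pk)
    also have "\<dots> \<le> \<rho> ^ k * (b' * (norm x)\<^sup>2)" using \<rho>(1) by (intro mult_left_mono p_le') auto
    finally show "(norm ((?f ^^ k) x))\<^sup>2 \<le> b' / c * \<rho> ^ k * (norm x)\<^sup>2"
      using c(1) by (simp add: field_simps)
  qed
qed

lemma partial_cost:
  "(\<Sum>k<N. stage_cost Q R (trajectory A B x0 u k) (u k)) + p (trajectory A B x0 u N)
    = p x0 + (\<Sum>k<N. s (u k - K (trajectory A B x0 u k)))"
proof (induction N)
  case (Suc N)
  then show ?case using bellman[of "trajectory A B x0 u N" "u N"] by simp
qed simp

text \<open>The limit of \<open>partial_cost\<close>: finite cost drives the state to 0, so the
  remaining value of \<open>p\<close> vanishes by its quadratic bound, and the excess over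
  \<open>p x0\<close> is exactly the total penalty.\<close>

lemma cost_sums:
  assumes "summable (\<lambda>k. stage_cost Q R (trajectory A B x0 u k) (u k))"
  shows "(\<lambda>k. s (u k - K (trajectory A B x0 u k))) sums
    ((\<Sum>k. stage_cost Q R (trajectory A B x0 u k) (u k)) - p x0)"
proof -
  let ?x = "trajectory A B x0 u" and ?g = "\<lambda>k. stage_cost Q R (trajectory A B x0 u k) (u k)"
  have "?x \<longlonglongrightarrow> 0"
    using lqr_cost_finiteD(2)[OF Q R] suminf_ereal_finite[OF assms] by (simp add: lqr_cost_stage)
  then have "(\<lambda>k. b * (norm (?x k))\<^sup>2) \<longlonglongrightarrow> b * (norm (0::complex^'n))\<^sup>2" by (intro tendsto_intros)
  then have "(\<lambda>k. p (?x k)) \<longlonglongrightarrow> 0"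
    by - (rule tendsto_zero_squeeze[of "\<lambda>k. b * (norm (?x k))\<^sup>2"], simp_all add: p_nonneg p_le)
  then have "(\<lambda>N. (\<Sum>k<N. ?g k) + p (?x N) - p x0) \<longlonglongrightarrow> (\<Sum>k. ?g k) + 0 - p x0"
    by (intro tendsto_intros summable_LIMSEQ assms)
  then show ?thesis by (simp add: sums_def partial_cost)
qed

lemma cost_ge: "ereal (p x0) \<le> lqr_cost A B Q R x0 u"
proof (cases "lqr_cost A B Q R x0 u = \<infinity>")
  case False
  note sm = lqr_cost_finiteD(1)[OF Q R False]
  have "0 \<le> (\<Sum>k. stage_cost Q R (trajectory A B x0 u k) (u k)) - p x0"
    using sums_le[OF _ sums_zero cost_sums[OF sm]] s_nonneg by blast
  then show ?thesis by (simp add: lqr_cost_stage suminf_ereal'[OF sm])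
qed simp

lemma cost_eq_iff:
  "lqr_cost A B Q R x0 u = ereal (p x0) \<longleftrightarrow> (\<forall>k. u k = K (trajectory A B x0 u k))"
proof
  let ?x = "trajectory A B x0 u"
  assume eq: "lqr_cost A B Q R x0 u = ereal (p x0)"
  then have sm: "summable (\<lambda>k. stage_cost Q R (?x k) (u k))" by (intro lqr_cost_finiteD(1)[OF Q R]) auto
  have "(\<lambda>k. s (u k - K (?x k))) sums 0"
    using cost_sums[OF sm] eq by (simp add: lqr_cost_stage suminf_ereal'[OF sm])
  then have "s (u k - K (?x k)) = 0" for k
    using suminf_eq_zero_iff[of "\<lambda>k. s (u k - K (?x k))"] s_nonneg
    by (auto simp: sums_iff)
  then show "\<forall>k. u k = K (?x k)" using s_pos by (metis eq_iff_diff_eq_0 less_irrefl)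
next
  let ?x = "trajectory A B x0 u"
  assume fb: "\<forall>k. u k = K (?x k)"
  \<comment> \<open>Summability has to be known before \<open>cost_sums\<close> applies. With all
    penalties 0, \<open>partial_cost\<close> bounds the partial sums by \<open>p x0\<close>.\<close>
  then have le: "(\<Sum>k<N. stage_cost Q R (?x k) (u k)) \<le> p x0" for N
    using partial_cost[of x0 u N] p_nonneg[of "?x N"] s_zero by simp
  then have sm: "summable (\<lambda>k. stage_cost Q R (?x k) (u k))"
    by (intro summableI_nonneg_bounded[of _ "p x0"]) (auto simp: stage_cost_nonneg Q R)
  have "(\<lambda>k. s (u k - K (?x k))) sums 0" using fb s_zero by simp
  then have "(\<Sum>k. stage_cost Q R (?x k) (u k)) - p x0 = 0"
    by (rule sums_unique2[OF cost_sums[OF sm]])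
  then show "lqr_cost A B Q R x0 u = ereal (p x0)"
    by (simp add: lqr_cost_stage suminf_ereal'[OF sm])
qed

text \<open>The feedback law refers to the trajectory that the control itself generates; iterating
  the closed-loop map first gives the control explicitly.\<close>

lemma optimal_control_exists: "\<exists>u. lqr_cost A B Q R x0 u = ereal (p x0)"
  unfolding cost_eq_iff
proof (intro exI allI)
  let ?f = "\<lambda>x. antilin_step A B x (K x)"
  show "K ((?f ^^ k) x0) = K (trajectory A B x0 (\<lambda>k. K ((?f ^^ k) x0)) k)" for k
    by (simp add: trajectory_feedback[of _ K A B x0])
qed

lemma optimal_cost: "(INF u. lqr_cost A B Q R x0 u) = ereal (p x0)"
proof (rule antisym)
  obtain u where "lqr_cost A B Q R x0 u = ereal (p x0)" using optimal_control_exists by blast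
  then show "(INF u. lqr_cost A B Q R x0 u) \<le> ereal (p x0)" by (metis INF_lower UNIV_I)
qed (rule INF_greatest, rule cost_ge)

lemma optimal_iff:
  "lqr_optimal A B Q R x0 u \<longleftrightarrow> (\<forall>k. u k = K (trajectory A B x0 u k))"
proof -
  have "lqr_optimal A B Q R x0 u \<longleftrightarrow> lqr_cost A B Q R x0 u = ereal (p x0)"
    unfolding lqr_optimal_def using optimal_control_exists cost_ge by (metis order_antisym)
  then show ?thesis using cost_eq_iff by simp
qed

lemma solvable: "lqr_solvable A B Q R"
  unfolding lqr_solvable_def
proof
  fix x0
  obtain u where u: "lqr_cost A B Q R x0 u = ereal (p x0)" using optimal_control_exists by blast
  then show "\<exists>u. lqr_optimal A B Q R x0 u \<and> \<bar>lqr_cost A B Q R x0 u\<bar> \<noteq> \<infinity>"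
    by (intro exI[of _ u]) (simp add: lqr_optimal_def cost_ge)
qed

end

subsection \<open>The anti-Riccati equation\<close>

text \<open>The Riccati iteration starts from 0, so definiteness cannot be demanded of all
  iterates.\<close>

definition psd_mat :: "complex^'n^'n \<Rightarrow> bool" where
  "psd_mat P \<longleftrightarrow> P\<^sup>H = P \<and> (\<forall>x. 0 \<le> x \<bullet> (P *v x))"

definition control_weight :: "complex^'m^'n \<Rightarrow> complex^'m^'m \<Rightarrow> complex^'n^'n \<Rightarrow> complex^'m^'m" where
  "control_weight B R P = R + B\<^sup>H ** P\<^sup># ** B"

text \<open>The dynamic programming operator on quadratic forms: by \<open>riccati_square\<close>
  its form at \<open>x\<close> is, for semidefinite \<open>P\<close>, the minimum over
  \<open>u\<close> of the stage cost plus the \<open>P\<close>-form at the next state. Its fixed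
  points solve the anti-Riccati equation.\<close>

definition riccati_map ::
    "complex^'n^'n \<Rightarrow> complex^'m^'n \<Rightarrow> complex^'n^'n \<Rightarrow> complex^'m^'m \<Rightarrow> complex^'n^'n \<Rightarrow> complex^'n^'n" where
  "riccati_map A B Q R P = Q + A\<^sup>H ** P\<^sup># ** A
    - A\<^sup>H ** P\<^sup># ** B ** matrix_inv (control_weight B R P) ** B\<^sup>H ** P\<^sup># ** A"

lemma pos_def_imp_psd: "pos_def_mat P \<Longrightarrow> psd_mat P"
  by (simp add: psd_mat_def pos_def_mat_nonneg) (simp add: pos_def_mat_def)

lemma psd_matI: "P\<^sup>H = P \<Longrightarrow> (\<And>x. 0 \<le> x \<bullet> (P *v x)) \<Longrightarrow> psd_mat P"
  by (simp add: psd_mat_def)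

lemma anti_riccati_iff: "anti_riccati A B Q R P \<longleftrightarrow> riccati_map A B Q R P = P"
  unfolding anti_riccati_def riccati_map_def control_weight_def by (auto simp: algebra_simps)

text \<open>Conjugation is a real isometry, so it can be moved from the vector to the matrix.
  Together with \<open>antilin_step_conj\<close> this is the source of \<open>P\<^sup>#\<close> in
  the anti-Riccati equation.\<close>

lemma conj_form: "conj_vec z \<bullet> (P *v conj_vec z) = z \<bullet> (P\<^sup># *v z)"
  by (metis conj_mat_conj conj_mat_vec inner_conj_vec)

lemma antilin_step_conj: "antilin_step A B x u = conj_vec (A *v x + B *v u)"
  by (simp add: antilin_step_def conj_mat_vec conj_vec_add)

lemma psd_mat_conj: "psd_mat P \<Longrightarrow> psd_mat (P\<^sup>#)"
  by (auto simp: psd_mat_def adj_mat_conj conj_form[symmetric])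

lemma pos_def_mat_inverse:
  assumes "pos_def_mat S"
  shows "S ** matrix_inv S = mat 1 \<and> matrix_inv S ** S = mat 1"
proof -
  have "\<forall>x. S *v x = 0 \<longrightarrow> x = 0"
    using assms by (metis Re_cdot inner_zero_right less_irrefl pos_def_mat_def)
  then obtain T where "T ** S = mat 1" using matrix_left_invertible_ker by blast
  then show ?thesis unfolding matrix_inv_def using matrix_left_right_inverse by (metis (mono_tags, lifting) someI_ex)
qed

lemma control_weight_inner:
  "z \<bullet> (control_weight B R P *v z) = z \<bullet> (R *v z) + (B *v z) \<bullet> (P\<^sup># *v (B *v z))"
  by (simp add: control_weight_def matrix_vector_mult_add_rdistrib inner_add
      adj_mat_inner_right flip: matrix_vector_mul_assoc)

lemma control_weight_hermitian:
  "R\<^sup>H = R \<Longrightarrow> P\<^sup>H = P \<Longrightarrow> (control_weight B R P)\<^sup>H = control_weight B R P"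
  by (simp add: control_weight_def adj_mat_add adj_mat_mult adj_mat_adj adj_mat_conj matrix_mul_assoc)

lemma control_weight_pos_def:
  assumes "psd_mat P" "pos_def_mat R"
  shows "pos_def_mat (control_weight B R P)"
  unfolding pos_def_mat_def
proof (intro conjI allI impI)
  show "(control_weight B R P)\<^sup>H = control_weight B R P"
    using assms by (intro control_weight_hermitian) (auto simp: psd_mat_def pos_def_mat_def)
  fix x :: "complex^'b" assume "x \<noteq> 0"
  then have "0 < x \<bullet> (R *v x)" using assms(2) by (simp add: pos_def_mat_def Re_cdot)
  then show "0 < Re (cdot x (control_weight B R P *v x))"
    using psd_mat_conj[OF assms(1)] by (simp add: psd_mat_def Re_cdot control_weight_inner add_pos_nonneg)
qed

lemma anti_gain_vec:
  "anti_gain A B R P *v x = - (matrix_inv (control_weight B R P) *v (B\<^sup>H *v (P\<^sup># *v (A *v x))))"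
  by (simp add: anti_gain_def matrix_vector_mult_minus matrix_vector_mul_assoc matrix_mul_assoc flip: control_weight_def)

lemma anti_gain_eq:
  assumes "psd_mat P" "pos_def_mat R"
  shows "control_weight B R P *v (anti_gain A B R P *v x) = - (B\<^sup>H *v (P\<^sup># *v (A *v x)))"
  using pos_def_mat_inverse[OF control_weight_pos_def[OF assms, of B]]
  by (simp add: anti_gain_vec linear_neg[OF linear_complex_matrix] matrix_vector_mul_assoc matrix_mul_assoc)

lemma riccati_map_vec:
  "riccati_map A B Q R P *v x = Q *v x + A\<^sup>H *v (P\<^sup># *v (A *v x + B *v (anti_gain A B R P *v x)))"
  by (simp add: riccati_map_def anti_gain_vec matrix_vector_mult_add_rdistrib
      matrix_vector_mult_diff_rdistrib linear_diff[OF linear_complex_matrix]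
      linear_neg[OF linear_complex_matrix] flip: matrix_vector_mul_assoc)

text \<open>This is \<open>completed_square\<close> at \<open>a = A *v x\<close> with
  \<open>W\<close> given by \<open>P\<^sup>#\<close>. As \<open>P\<close> need not be a fixed point,
  it yields Bellman's equation for a solution and also controls every iterate.\<close>

lemma riccati_square:
  assumes "psd_mat P" "pos_def_mat R"
  shows "stage_cost Q R x u + antilin_step A B x u \<bullet> (P *v antilin_step A B x u)
    = x \<bullet> (riccati_map A B Q R P *v x)
      + (u - anti_gain A B R P *v x) \<bullet> (control_weight B R P *v (u - anti_gain A B R P *v x))"
proof -
  have herm: "R\<^sup>H = R" "(P\<^sup>#)\<^sup>H = P\<^sup>#"
    using assms psd_mat_conj by (auto simp: pos_def_mat_def psd_mat_def)
  have S: "control_weight B R P *v z = R *v z + B\<^sup>H *v (P\<^sup># *v (B *v z))" for z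
    by (simp add: control_weight_def matrix_vector_mult_add_rdistrib flip: matrix_vector_mul_assoc)
  note completed_square[where W = "(*v) (P\<^sup>#)" and R = "(*v) R" and G = "(*v) B" and G' = "(*v) (B\<^sup>H)",
      OF linear_complex_matrix hermitian_inner[OF herm(2)]
      linear_complex_matrix hermitian_inner[OF herm(1)] linear_complex_matrix adj_mat_inner
      linear_complex_matrix anti_gain_eq[OF assms, of B A x, unfolded S], of u]
  then show ?thesis
    by (simp add: antilin_step_conj conj_form stage_cost_def riccati_map_vec inner_add S
        adj_mat_inner_right)
qed

lemma anti_riccati_value:
  assumes "pos_def_mat Q" "pos_def_mat R" "pos_def_mat P" "anti_riccati A B Q R P"
  obtains b where "value_function A B Q R (\<lambda>x. x \<bullet> (P *v x))
    (\<lambda>z. z \<bullet> (control_weight B R P *v z)) ((*v) (anti_gain A B R P)) b"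
proof -
  note psd = pos_def_imp_psd[OF assms(3)]
  obtain b where b: "b > 0" "\<And>x. x \<bullet> (P *v x) \<le> b * (norm x)\<^sup>2"
    using form_upper[OF linear_complex_matrix] by blast
  show thesis
  proof (rule that, unfold_locales)
    show "stage_cost Q R x u + antilin_step A B x u \<bullet> (P *v antilin_step A B x u)
    = x \<bullet> (P *v x) + (u - anti_gain A B R P *v x) \<bullet> (control_weight B R P *v (u - anti_gain A B R P *v x))" for x u
      using riccati_square[OF psd assms(2), of Q x u A B] assms(4) by (simp add: anti_riccati_iff)
    show "0 < z \<bullet> (control_weight B R P *v z)" if "z \<noteq> 0" for z
      using control_weight_pos_def[OF psd assms(2), of B] that by (simp add: pos_def_mat_def Re_cdot)
  qed (use assms psd b in \<open>auto simp: psd_mat_def\<close>)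
qed

subsection \<open>The bimatrix Riccati equation\<close>

lemma linear_bimat_apply: "linear (bimat_apply M)"
proof -
  have "linear (\<lambda>x. fst M *v x + (snd M)\<^sup># *v conj_vec x)"
    by (intro linear_compose_add linear_complex_matrix
        linear_compose[OF linear_conj_vec linear_complex_matrix, unfolded o_def])
  then show ?thesis by (simp add: bimat_apply_def[abs_def])
qed

text \<open>The transpose in the second component is what the real adjoint requires: the adjoint of
  the antilinear part with matrix \<open>M\<^sup>#\<close> is antilinear with matrix
  \<open>M\<^sup>H\<close>, the conjugate of \<open>transpose M\<close>.\<close>

lemma bimat_adj_inner: "bimat_apply (bimat_adj M) x \<bullet> y = x \<bullet> bimat_apply M y"
proof -
  have T: "(transpose (snd M))\<^sup># = (snd M)\<^sup>H" by (simp add: adj_mat_def vec_eq_iff transpose_def)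
  have "conj_vec x \<bullet> (snd M *v y) = x \<bullet> ((snd M)\<^sup># *v conj_vec y)"
    by (metis conj_vec_conj conj_mat_vec inner_conj_vec)
  then show ?thesis by (simp add: bimat_apply_def bimat_adj_def inner_add T adj_mat_inner)
qed

lemma bimat_adj_inner_right: "y \<bullet> bimat_apply (bimat_adj M) x = bimat_apply M y \<bullet> x"
  by (metis bimat_adj_inner inner_commute)

lemma bimat_apply_add: "bimat_apply (M + N) x = bimat_apply M x + bimat_apply N x"
  by (simp add: bimat_apply_def conj_mat_add matrix_vector_mult_add_rdistrib)

lemma bimat_apply_minus: "bimat_apply (- M) x = - bimat_apply M x"
proof -
  have "(- snd M)\<^sup># = - ((snd M)\<^sup>#)" by (simp add: vec_eq_iff)
  then show ?thesis by (simp add: bimat_apply_def matrix_vector_mult_minus)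
qed

lemma bimat_apply_diff: "bimat_apply (M - N) x = bimat_apply M x - bimat_apply N x"
  using bimat_apply_add[of M "- N"] by (simp add: bimat_apply_minus)

lemma conj_vec_axis: "conj_vec (axis j c) = axis j (cnj c)"
  by (simp add: vec_eq_iff conj_vec_def axis_def)

text \<open>Evaluation at \<open>axis j 1\<close> and \<open>axis j \<i>\<close> gives the sum and,
  up to the factor \<open>\<i>\<close>, the difference of an entry of the first component and the
  conjugate entry of the second.\<close>

lemma bimat_eqI:
  assumes "\<And>x. bimat_apply M x = bimat_apply N x"
  shows "M = N"
proof -
  have "fst M $ i $ j = fst N $ i $ j \<and> snd M $ i $ j = snd N $ i $ j" for i j
  proof -
    have 1: "fst M $ i $ j + cnj (snd M $ i $ j) = fst N $ i $ j + cnj (snd N $ i $ j)"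
      using arg_cong[OF assms[of "axis j 1"], of "\<lambda>v. v $ i"]
      by (simp add: bimat_apply_def matrix_vector_mult_axis conj_vec_axis)
    have 2: "fst M $ i $ j * \<i> - cnj (snd M $ i $ j) * \<i> = fst N $ i $ j * \<i> - cnj (snd N $ i $ j) * \<i>"
      using arg_cong[OF assms[of "axis j \<i>"], of "\<lambda>v. v $ i"]
      by (simp add: bimat_apply_def matrix_vector_mult_axis conj_vec_axis)
    show ?thesis using 1 2 by (auto simp: complex_eq_iff)
  qed
  then show ?thesis by (simp add: prod_eq_iff vec_eq_iff)
qed

lemma vec_axis_expansion:
  "x = (\<Sum>j\<in>UNIV. Re (x $ j) *\<^sub>R axis j 1 + Im (x $ j) *\<^sub>R axis j \<i>)" for x :: "complex^'n"
proof -
  have "(Re (x $ j) *\<^sub>R axis j 1 + Im (x $ j) *\<^sub>R axis j \<i>) $ i = (if i = j then x $ j else 0)" for i j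
    by (simp add: axis_def complex_eq_iff)
  then show ?thesis by (simp add: vec_eq_iff)
qed

text \<open>Every real-linear map splits into a complex-linear part,
  \<open>(L 1 - \<i> * L \<i>) / 2\<close> on each axis, and an antilinear part with the opposite
  sign. The extra \<open>cnj\<close> undoes the conjugation built into
  \<open>bimat_apply\<close>.\<close>

lemma linear_is_bimat:
  fixes L :: "complex^'q \<Rightarrow> complex^'p"
  assumes "linear L"
  obtains M where "\<And>x. bimat_apply M x = L x"
proof -
  define M :: "('q, 'p) bimatrix" where
    "M = ((\<chi> i j. (L (axis j 1) $ i - \<i> * L (axis j \<i>) $ i) / 2),
          (\<chi> i j. cnj ((L (axis j 1) $ i + \<i> * L (axis j \<i>) $ i) / 2)))"
  have "bimat_apply M x = L x" for x
  proof -
    have *: "fst M $ i $ j * x $ j + cnj (snd M $ i $ j) * cnj (x $ j)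
        = Re (x $ j) * L (axis j 1) $ i + Im (x $ j) * L (axis j \<i>) $ i" for i j
      by (simp add: M_def complex_eq_iff field_simps)
    have "L x = (\<Sum>j\<in>UNIV. Re (x $ j) *\<^sub>R L (axis j 1) + Im (x $ j) *\<^sub>R L (axis j \<i>))"
      by (subst vec_axis_expansion[of x])
        (simp add: linear_sum[OF assms] linear_add[OF assms] linear_cmul[OF assms])
    then show ?thesis
      by (simp add: vec_eq_iff bimat_apply_def matrix_vector_mult_def conj_vec_def
          scaleR_conv_of_real[where 'a = complex] flip: * sum.distrib)
  qed
  then show thesis by (rule that)
qed

lemma bimat_inv_eq:
  assumes "S \<odot> N = bimat_one" "N \<odot> S = bimat_one"
  shows "bimat_inv S = N"
  unfolding bimat_inv_def
proof (rule some_equality)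
  show "N' = N" if "S \<odot> N' = bimat_one \<and> N' \<odot> S = bimat_one" for N'
  proof (rule bimat_eqI)
    fix x
    have "bimat_apply N' x = bimat_apply (N' \<odot> S) (bimat_apply N x)"
      using assms(1) by (metis bimat_apply_mult bimat_apply_one)
    then show "bimat_apply N' x = bimat_apply N x" using that by (simp add: bimat_apply_one)
  qed
qed (use assms in simp)

text \<open>An injective real-linear endomorphism is bijective in finite dimension, and by
  \<open>linear_is_bimat\<close> its inverse is again a bimatrix. Hence the choice in
  \<open>bimat_inv\<close> has a witness.\<close>

lemma bimat_inv_apply:
  assumes "\<And>x. bimat_apply S x = 0 \<Longrightarrow> x = 0"
  shows "bimat_apply S (bimat_apply (bimat_inv S) x) = x"
proof -
  have inj: "inj (bimat_apply S)"
    using assms linear_injective_0[OF linear_bimat_apply] by blast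
  obtain g where g: "linear g" "g \<circ> bimat_apply S = id"
    using linear_injective_left_inverse[OF linear_bimat_apply inj] by blast
  have gS: "bimat_apply S (g x) = x" "g (bimat_apply S x) = x" for x
    using fun_cong[OF g(2)] linear_injective_imp_surjective[OF linear_bimat_apply inj]
    by (auto simp: surj_def) metis
  obtain N where N: "\<And>x. bimat_apply N x = g x" using linear_is_bimat[OF g(1)] by blast
  have "bimat_inv S = N"
    by (rule bimat_inv_eq; rule bimat_eqI) (simp_all add: bimat_apply_mult bimat_apply_one N gS)
  then show ?thesis by (simp add: N gS)
qed

lemma antilin_step_bimat: "antilin_step A B x u = bimat_apply (0, A) x + bimat_apply (0, B) u"
  by (simp add: antilin_step_def bimat_apply_def)

lemma bimat_apply_fst: "bimat_apply (M, 0) x = M *v x"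
  by (simp add: bimat_apply_def conj_mat_zero)

text \<open>The gain \<open>K\<close> may contain an antilinear part. \<open>K\<close> and
  \<open>s\<close> stay existential because the uniqueness argument only compares optimal
  costs.\<close>

lemma bimat_riccati_value:
  assumes Q: "pos_def_mat Q" and R: "pos_def_mat R"
    and P: "pos_def_bimat P" and ric: "bimat_riccati A B Q R P"
  obtains K s b where "value_function A B Q R (\<lambda>x. x \<bullet> bimat_apply P x) s K b"
proof -
  let ?F = "bimat_apply (0, A)" and ?G = "bimat_apply (0, B)" and ?W = "bimat_apply P"
  let ?F' = "bimat_apply (bimat_adj (0, A))" and ?G' = "bimat_apply (bimat_adj (0, B))"
  define S where "S = (R, 0) + bimat_adj (0, B) \<odot> P \<odot> (0, B)"
  define K where "K x = - bimat_apply (bimat_inv S) (?G' (?W (?F x)))" for x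
  have W: "?W x \<bullet> y = x \<bullet> ?W y" for x y
    using P bimat_adj_inner by (metis pos_def_bimat_def)
  have W_pos: "0 < x \<bullet> ?W x" if "x \<noteq> 0" for x
    using P that by (simp add: pos_def_bimat_def Re_cdot)
  then have W_nonneg: "0 \<le> x \<bullet> ?W x" for x by (cases "x = 0") (auto simp: less_imp_le)
  have S: "bimat_apply S u = R *v u + ?G' (?W (?G u))" for u
    by (simp add: S_def bimat_apply_add bimat_apply_mult bimat_apply_fst)
  have S_pos: "0 < u \<bullet> bimat_apply S u" if "u \<noteq> 0" for u
  proof -
    show ?thesis
      using W_nonneg[of "?G u"] R that by (simp add: S inner_add bimat_adj_inner_right pos_def_mat_def Re_cdot add_pos_nonneg)
  qed
  have "bimat_apply S (bimat_apply (bimat_inv S) u) = u" for u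
    by (rule bimat_inv_apply) (metis S_pos inner_zero_right less_irrefl)
  then have K: "R *v K x + ?G' (?W (?G (K x))) = - ?G' (?W (?F x))" for x
    using S[of "K x"] by (simp add: K_def linear_neg[OF linear_bimat_apply])
  have ric0: "bimat_apply (- (Q, 0)) x = ?F' (?W (?F x)) - ?W x + ?F' (?W (?G (K x)))" for x
    using ric by (simp add: bimat_riccati_def Let_def bimat_apply_diff bimat_apply_mult K_def
        linear_neg[OF linear_bimat_apply] flip: S_def)
  have ric': "?W x = Q *v x + ?F' (?W (?F x + ?G (K x)))" for x
    using ric0[of x] unfolding bimat_apply_minus bimat_apply_fst linear_add[OF linear_bimat_apply]
    by (simp add: algebra_simps minus_equation_iff)
  obtain b where b: "b > 0" "\<And>x. x \<bullet> ?W x \<le> b * (norm x)\<^sup>2"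
    using form_upper[OF linear_bimat_apply] by blast
  have "value_function A B Q R (\<lambda>x. x \<bullet> ?W x) (\<lambda>u. u \<bullet> bimat_apply S u) K b"
  proof unfold_locales
    fix x u
    have "x \<bullet> ?W x = x \<bullet> (Q *v x) + ?F x \<bullet> ?W (?F x + ?G (K x))"
      by (subst ric') (simp only: inner_add_right bimat_adj_inner_right)
    moreover have "R\<^sup>H = R" using R by (simp add: pos_def_mat_def)
    note completed_square[where W = ?W and R = "(*v) R" and G = ?G and G' = ?G', OF linear_bimat_apply W
       linear_complex_matrix hermitian_inner[OF this] linear_bimat_apply bimat_adj_inner linear_bimat_apply
       K[of x], of u]
    ultimately show "stage_cost Q R x u + antilin_step A B x u \<bullet> ?W (antilin_step A B x u)
      = x \<bullet> ?W x + (u - K x) \<bullet> bimat_apply S (u - K x)"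
      by (simp add: stage_cost_def antilin_step_bimat S)
  qed (use Q R W_nonneg S_pos b in auto)
  then show thesis by (rule that)
qed

lemma pos_def_bimat_fst: "pos_def_mat P \<Longrightarrow> pos_def_bimat (P, 0)"
  by (auto simp: pos_def_mat_def pos_def_bimat_def bimat_adj_def bimat_apply_fst transpose_def vec_eq_iff)

text \<open>A product with an antilinear factor on each side of \<open>(P, 0)\<close> is
  complex-linear again, so the second component of the equation is trivial and the first is the
  anti-Riccati equation.\<close>

lemma anti_riccati_imp_bimat:
  assumes R: "pos_def_mat R" and P: "pos_def_mat P" and "anti_riccati A B Q R P"
  shows "bimat_riccati A B Q R (P, 0)"
proof -
  let ?S = "control_weight B R P"
  note inv = pos_def_mat_inverse[OF control_weight_pos_def[OF pos_def_imp_psd[OF P] R, of B]]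
  have S: "(R, 0) + bimat_adj (0, B) \<odot> (P, 0) \<odot> (0, B) = (?S, 0)"
    by (simp add: bimat_mult_def bimat_adj_def control_weight_def conj_mat_zero adj_mat_zero
        conj_mat_mult conj_mat_transpose conj_mat_adj conj_mat_conj matrix_mul_assoc)
  have "bimat_inv (?S, 0) = (matrix_inv ?S, 0)"
    using inv by (intro bimat_inv_eq) (simp_all add: bimat_mult_def bimat_one_def conj_mat_zero)
  then show ?thesis
    using assms(3)
    by (simp add: bimat_riccati_def S Let_def)
      (simp add: bimat_mult_def bimat_adj_def anti_riccati_def conj_mat_zero adj_mat_zero
        conj_mat_mult conj_mat_transpose conj_mat_adj conj_mat_conj matrix_mul_assoc control_weight_def)
qed

text \<open>Both forms equal the infimum of the cost from every initial state. Comparing with an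
  arbitrary bimatrix also settles uniqueness among matrices.\<close>

lemma riccati_solution_unique:
  assumes "pos_def_mat Q" "pos_def_mat R" "pos_def_mat P" "anti_riccati A B Q R P"
    and "pos_def_bimat P'" "bimat_riccati A B Q R P'"
  shows "P' = (P, 0)"
proof (rule bimat_eqI)
  fix x
  obtain b where "value_function A B Q R (\<lambda>x. x \<bullet> (P *v x))
    (\<lambda>z. z \<bullet> (control_weight B R P *v z)) ((*v) (anti_gain A B R P)) b"
    using anti_riccati_value assms by blast
  moreover obtain K s b where "value_function A B Q R (\<lambda>x. x \<bullet> bimat_apply P' x) s K b"
    using bimat_riccati_value assms by blast
  ultimately have "x \<bullet> bimat_apply P' x = x \<bullet> (P *v x)" for x
    by (metis value_function.optimal_cost ereal.inject)
  moreover have "bimat_apply P' x \<bullet> y = x \<bullet> bimat_apply P' y" for x y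
    using assms(5) bimat_adj_inner by (metis pos_def_bimat_def)
  moreover have "P\<^sup>H = P" using assms(3) by (simp add: pos_def_mat_def)
  ultimately show "bimat_apply P' x = bimat_apply (P, 0) x"
    using sym_form_unique[OF linear_bimat_apply _ linear_complex_matrix hermitian_inner]
    unfolding bimat_apply_fst by blast
qed

subsection \<open>The rank condition\<close>

declare transpose_matrix_vector [simp del]

lemma transpose_mult_vec: "transpose C *v w = (\<Sum>i\<in>UNIV. w $ i *s row i C)" for C :: "complex^'k^'n"
  by (simp add: matrix_mult_sum column_transpose)

text \<open>\<open>rows C\<close> is a set, so independence of this set says nothing about repeated
  rows; both directions need the separate fact that the rows are distinct.\<close>

lemma rank_full_iff:
  fixes C :: "complex^'k^'n"
  shows "rank C = CARD('n) \<longleftrightarrow> (\<forall>w. transpose C *v w = 0 \<longrightarrow> w = 0)"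
proof -
  have rows: "rows C = (\<lambda>i. row i C) ` UNIV" by (auto simp: rows_def)
  have fin: "finite (rows C)" by (simp add: rows)
  have le: "card (rows C) \<le> CARD('n)" unfolding rows by (rule card_image_le) simp
  show ?thesis
  proof (intro iffI allI impI)
    fix w assume rk: "rank C = CARD('n)" and w: "transpose C *v w = 0"
    have "vec.dim (rows C) \<le> card (rows C)"
      by (rule vec.dim_le_card[OF vec.span_superset fin])
    then have card: "card (rows C) = CARD('n)" "card (rows C) = vec.dim (rows C)"
      using rk le by (auto simp: row_rank_def_gen)
    have indep: "vec.independent (rows C)"
      using vec.card_eq_dim[OF subset_refl card(2) fin] vec.span_superset by blast
    have inj: "inj (\<lambda>i. row i C)"
      using card(1) unfolding rows by (simp add: inj_on_iff_eq_card)
    have "(\<Sum>v\<in>rows C. w $ (inv (\<lambda>i. row i C) v) *s v) = (\<Sum>i\<in>UNIV. w $ i *s row i C)"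
      unfolding rows by (subst sum.reindex[OF inj]) (simp add: inv_f_f[OF inj])
    then have "(\<Sum>v\<in>rows C. w $ (inv (\<lambda>i. row i C) v) *s v) = 0" using w by (simp add: transpose_mult_vec)
    from vec.independentD[OF indep fin subset_refl this]
    have "w $ (inv (\<lambda>i. row i C) (row i C)) = 0" for i by (auto simp: rows)
    then show "w = 0" by (simp add: vec_eq_iff inv_f_f[OF inj])
  next
    assume ker: "\<forall>w. transpose C *v w = 0 \<longrightarrow> w = 0"
    have inj: "inj (\<lambda>i. row i C)"
    proof (rule injI, rule ccontr)
      fix i j assume ij: "row i C = row j C" "i \<noteq> j"
      have "transpose C *v (axis i 1 - axis j 1) = 0"
        using ij(1) by (simp add: linear_diff[OF linear_complex_matrix] vec_eq_iff
            matrix_vector_mult_axis transpose_def row_def)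
      then have "axis i 1 - axis j (1::complex) = 0" using ker by blast
      then show False using ij(2) by (simp add: axis_eq_axis)
    qed
    have "vec.independent (rows C)"
    proof (rule vec.independent_if_scalars_zero[OF fin])
      fix g v assume g: "(\<Sum>x\<in>rows C. g x *s x) = 0" and "v \<in> rows C"
      then obtain i where v: "v = row i C" by (auto simp: rows)
      have "transpose C *v (\<chi> i. g (row i C)) = 0"
        using g unfolding rows by (simp add: sum.reindex[OF inj] transpose_mult_vec)
      then have "(\<chi> i. g (row i C)) = 0" using ker by blast
      then show "g v = 0" by (simp add: v vec_eq_iff)
    qed
    then have "rank C = card (rows C)" by (simp add: row_rank_def_gen vec.dim_eq_card_independent)
    also have "\<dots> = CARD('n)" unfolding rows by (rule card_image[OF inj])
    finally show "rank C = CARD('n)" .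
  qed
qed

lemma block_row3_kernel:
  "transpose (block_row3 M1 M2 M3) *v w = 0 \<longleftrightarrow>
    transpose M1 *v w = 0 \<and> transpose M2 *v w = 0 \<and> transpose M3 *v w = 0"
proof -
  have 1: "(transpose (block_row3 M1 M2 M3) *v w) $ Inl a = (transpose M1 *v w) $ a"
    "(transpose (block_row3 M1 M2 M3) *v w) $ Inr (Inl b) = (transpose M2 *v w) $ b"
    "(transpose (block_row3 M1 M2 M3) *v w) $ Inr (Inr c) = (transpose M3 *v w) $ c" for a b c
    by (simp_all add: block_row3_def transpose_def matrix_vector_mult_def)
  show ?thesis
  proof
    assume "transpose (block_row3 M1 M2 M3) *v w = 0"
    then show "transpose M1 *v w = 0 \<and> transpose M2 *v w = 0 \<and> transpose M3 *v w = 0"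
      using 1 by (simp add: vec_eq_iff)
  next
    assume "transpose M1 *v w = 0 \<and> transpose M2 *v w = 0 \<and> transpose M3 *v w = 0"
    then show "transpose (block_row3 M1 M2 M3) *v w = 0"
      using 1 unfolding vec_eq_iff by (metis sum.exhaust zero_index)
  qed
qed

text \<open>The left null vectors of the block row, since \<open>A\<^sup>H ** transpose A\<close> is
  the transpose of \<open>A ** A\<^sup>#\<close>. Equivalently, eigenvectors of the adjoint of the
  two-step matrix \<open>A\<^sup># ** A\<close> that are orthogonal to the effect of both inputs:
  the Hautus test for two steps.\<close>

definition uncontrollable_mode :: "complex^'n^'n \<Rightarrow> complex^'m^'n \<Rightarrow> complex \<Rightarrow> complex^'n \<Rightarrow> bool" where
  "uncontrollable_mode A B l w \<longleftrightarrow> A\<^sup>H *v (transpose A *v w) = l *s w \<and>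
     transpose B *v w = 0 \<and> B\<^sup>H *v (transpose A *v w) = 0"

lemma hautus_rank_iff:
  fixes A :: "complex^'n^'n" and B :: "complex^'m^'n"
  shows "rank (block_row3 (mat l - A ** A\<^sup>#) B (A ** B\<^sup>#)) = CARD('n)
    \<longleftrightarrow> (\<forall>w. uncontrollable_mode A B l w \<longrightarrow> w = 0)"
proof -
  have "transpose (mat l - A ** A\<^sup>#) *v w = 0 \<longleftrightarrow> A\<^sup>H *v (transpose A *v w) = l *s w" for w
  proof -
    have "transpose (mat l - A ** A\<^sup>#) = transpose (mat l) - transpose (A ** A\<^sup>#)"
      by (simp add: vec_eq_iff transpose_def)
    moreover have "mat l *v w = l *s w"
      by (simp add: vec_eq_iff matrix_vector_mult_def mat_def if_distrib[of "\<lambda>x. x * _"] cong: if_cong)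
    ultimately have "transpose (mat l - A ** A\<^sup>#) *v w = l *s w - A\<^sup>H *v (transpose A *v w)"
      by (simp add: matrix_vector_mult_diff_rdistrib matrix_transpose_mul matrix_vector_mul_assoc adj_mat_def)
    then show ?thesis by auto
  qed
  moreover have "transpose (A ** B\<^sup>#) *v w = B\<^sup>H *v (transpose A *v w)" for w
    by (simp add: matrix_transpose_mul matrix_vector_mul_assoc adj_mat_def)
  ultimately show ?thesis
    by (simp add: rank_full_iff block_row3_kernel uncontrollable_mode_def)
qed

lemma cdot_conj_transpose: "cdot (conj_vec (M *v x)) y = cdot (conj_vec x) (transpose M *v y)"
  by (simp add: conj_mat_vec cdot_adj) (simp add: adj_mat_def conj_mat_conj)

lemma cdot_add_left: "cdot (x + y) z = cdot x z + cdot y z"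
  by (simp add: cdot_def distrib_right sum.distrib)

text \<open>The later input \<open>v\<close> is killed by \<open>transpose B *v w = 0\<close>, the
  earlier \<open>u\<close> by the third condition. The second conjugation cancels the first, so the
  factor is \<open>l\<close> itself.\<close>

lemma uncontrollable_mode_two_steps:
  assumes "uncontrollable_mode A B l w"
  shows "cdot (antilin_step A B (antilin_step A B x u) v) w = l * cdot x w"
proof -
  have "cdot (antilin_step A B (antilin_step A B x u) v) w
      = cdot (conj_vec (antilin_step A B x u)) (transpose A *v w)"
    using assms by (simp add: antilin_step_conj[of _ _ _ v] conj_vec_add cdot_add_left cdot_conj_transpose
       uncontrollable_mode_def) (simp add: cdot_def)
  also have "\<dots> = cdot x (l *s w)"
    using assms by (simp add: antilin_step_conj conj_vec_conj cdot_add_left cdot_adj uncontrollable_mode_def)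
     (simp add: cdot_def)
  finally show ?thesis by (simp add: cdot_def sum_distrib_left mult_ac)
qed

text \<open>The hypothesis on trajectories is what stabilizability and solvability have in common.
  Starting from \<open>w\<close>, the component along \<open>w\<close> at even times has modulus at
  least its initial one.\<close>

lemma hautus_necessary:
  assumes "\<And>x0. \<exists>x u. x 0 = x0 \<and> (\<forall>k::nat. x (Suc k) = antilin_step A B (x k) (u k)) \<and> x \<longlonglongrightarrow> 0"
    and w: "uncontrollable_mode A B l w" and l: "1 \<le> cmod l"
  shows "w = 0"
proof -
  obtain x u where x: "x 0 = w" "\<And>k::nat. x (Suc k) = antilin_step A B (x k) (u k)" "x \<longlonglongrightarrow> 0"
    using assms(1)[of w] by metis
  have eq: "cdot (x (2 * k)) w = l ^ k * cdot w w" for k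
    by (induction k) (simp_all add: x(1,2) uncontrollable_mode_two_steps[OF w])
  have "(\<lambda>k. x (2 * k)) \<longlonglongrightarrow> 0"
    by (rule LIMSEQ_subseq_LIMSEQ[OF x(3), of "\<lambda>k. 2 * k", unfolded o_def]) (simp add: strict_mono_def)
  then have "(\<lambda>k. cdot (x (2 * k)) w) \<longlonglongrightarrow> cdot 0 w"
    unfolding cdot_def by (intro tendsto_intros)
  moreover have cdot_zero: "cdot 0 w = 0" by (simp add: cdot_def)
  ultimately have "(\<lambda>k. cmod (l ^ k * cdot w w)) \<longlonglongrightarrow> 0"
    using cdot_zero by (intro tendsto_norm_zero) (simp only: eq)
  moreover have "cmod (cdot w w) \<le> cmod (l ^ k * cdot w w)" for k
    using mult_right_mono[OF one_le_power[OF l, of k], of "cmod (cdot w w)"]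
    by (simp add: norm_mult norm_power)
  ultimately have "cmod (cdot w w) \<le> 0" by (intro LIMSEQ_le_const) auto
  then have "Re (cdot w w) = 0" by simp
  then show "w = 0" by (simp add: Re_cdot)
qed

section \<open>Polynomials in a matrix and eigenvectors in invariant subspaces\<close>

definition mat_poly_apply :: "complex^'n^'n \<Rightarrow> complex poly \<Rightarrow> complex^'n \<Rightarrow> complex^'n" where
  "mat_poly_apply M p x = fold_coeffs (\<lambda>a v. a *s x + M *v v) p 0"

lemma mat_poly_apply_0: "mat_poly_apply M 0 x = 0"
  by (simp add: mat_poly_apply_def)

lemma mat_poly_apply_pCons: "mat_poly_apply M (pCons a p) x = a *s x + M *v mat_poly_apply M p x"
  by (cases "a = 0 \<and> p = 0") (auto simp: mat_poly_apply_def)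

lemma mat_poly_apply_add: "mat_poly_apply M (p + q) x = mat_poly_apply M p x + mat_poly_apply M q x"
  by (induction p q rule: poly_induct2)
    (simp_all add: mat_poly_apply_0 mat_poly_apply_pCons vec.scale_left_distrib
      matrix_vector_right_distrib algebra_simps)

lemma mat_poly_apply_smult: "mat_poly_apply M (smult c p) x = c *s mat_poly_apply M p x"
  by (induction p) (simp_all add: mat_poly_apply_0 mat_poly_apply_pCons vec.scale_right_distrib
      vector_scalar_commute)

lemma mat_poly_apply_monom: "mat_poly_apply M (monom c i) x = c *s (((*v) M ^^ i) x)"
  by (induction i) (simp_all add: monom_0 monom_Suc mat_poly_apply_0 mat_poly_apply_pCons vector_scalar_commute)

lemma mat_poly_apply_sum: "mat_poly_apply M (\<Sum>i\<in>I. p i) x = (\<Sum>i\<in>I. mat_poly_apply M (p i) x)"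
  by (induction I rule: infinite_finite_induct) (simp_all add: mat_poly_apply_0 mat_poly_apply_add)

lemma mat_poly_apply_linear_factor:
  "mat_poly_apply M ([:- l, 1:] * p) x = mat_poly_apply M p (M *v x - l *s x)"
proof -
  have "mat_poly_apply M p (M *v x - l *s x) = M *v mat_poly_apply M p x - l *s mat_poly_apply M p x"
  proof (induction p)
    case (pCons a p)
    show ?case
      by (simp add: mat_poly_apply_pCons pCons.IH vec.scale_right_distrib vec.scale_right_diff_distrib
          vector_scalar_commute linear_add[OF linear_complex_matrix] linear_diff[OF linear_complex_matrix])
  qed (simp add: mat_poly_apply_0)
  moreover have "[:- l, 1:] * p = smult (- l) p + pCons 0 p" by simp
  ultimately show ?thesis
    by (simp only: mat_poly_apply_add mat_poly_apply_smult mat_poly_apply_pCons) simp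
qed

text \<open>Split off a root \<open>l\<close> of \<open>p\<close>. Either \<open>x\<close> is an
  eigenvector for \<open>l\<close>, or \<open>M *v x - l *s x\<close> is a nonzero vector of
  \<open>Y\<close> annihilated by the cofactor, which has smaller degree.\<close>

lemma eigenvector_of_annihilating_poly:
  assumes Y: "subspace Y" "\<And>c y. y \<in> Y \<Longrightarrow> c *s y \<in> Y" "\<And>y. y \<in> Y \<Longrightarrow> M *v y \<in> Y"
    and "p \<noteq> 0" "mat_poly_apply M p x = 0" "x \<in> Y" "x \<noteq> 0"
  shows "\<exists>l w. w \<in> Y \<and> w \<noteq> 0 \<and> M *v w = l *s w"
  using assms(4-)
proof (induction "degree p" arbitrary: p x)
  case 0
  then obtain c where "p = [:c:]" by (metis degree_0_id)
  then show ?case using 0 by (auto simp: mat_poly_apply_pCons mat_poly_apply_0)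
next
  case (Suc d)
  have "\<not> constant (poly p)" using Suc.hyps(2) by (simp add: constant_degree)
  then obtain l where "poly p l = 0" using fundamental_theorem_of_algebra by blast
  then obtain q where q: "p = [:- l, 1:] * q" by (auto simp: poly_eq_0_iff_dvd dvd_def)
  have q0: "q \<noteq> 0" using q Suc.prems(1) by auto
  have dq: "d = degree q" using Suc.hyps(2) q0 unfolding q by (subst (asm) degree_mult_eq) auto
  have *: "mat_poly_apply M q (M *v x - l *s x) = 0"
    using Suc.prems(2) unfolding q by (simp only: mat_poly_apply_linear_factor)
  show ?case
  proof (cases "M *v x - l *s x = 0")
    case True
    then show ?thesis using Suc.prems by (intro exI[of _ l] exI[of _ x]) simp
  next
    case False
    then show ?thesis using Suc.hyps(1)[OF dq q0 * _ False] Suc.prems Y by (simp add: subspace_diff)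
  qed
qed

lemma invariant_subspace_eigenvector:
  fixes M :: "complex^'n^'n"
  assumes Y: "subspace Y" "\<And>c y. y \<in> Y \<Longrightarrow> c *s y \<in> Y" "\<And>y. y \<in> Y \<Longrightarrow> M *v y \<in> Y"
    and x: "x \<in> Y" "x \<noteq> 0"
  obtains l w where "w \<in> Y" "w \<noteq> 0" "M *v w = l *s w"
proof -
  define f where "f i = ((*v) M ^^ i) x" for i
  let ?I = "{..DIM(complex^'n)}"
  have "\<exists>p. p \<noteq> 0 \<and> mat_poly_apply M p x = 0"
  \<comment> \<open>\<open>?I\<close> has one index more than the real dimension, so the powers of
    \<open>M\<close> applied to \<open>x\<close> are dependent over the reals, unless two coincide
    and the image set is too small; a coincidence gives an annihilating polynomial directly.\<close>
  proof (cases "inj_on f ?I")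
    case False
    then obtain i j where ij: "i \<noteq> j" "f i = f j" by (auto simp: inj_on_def)
    let ?p = "monom 1 i + monom (- 1) j :: complex poly"
    have "coeff ?p i = 1" using ij(1) by simp
    then have "?p \<noteq> 0" by (metis coeff_0 zero_neq_one)
    moreover have "mat_poly_apply M ?p x = 0"
      using ij(2) by (simp add: mat_poly_apply_add mat_poly_apply_monom f_def)
    ultimately show ?thesis by blast
  next
    case True
    then have "dependent (f ` ?I)" by (intro dependent_biggerset) (simp add: card_image)
    then obtain g v where g: "(\<Sum>y\<in>f ` ?I. g y *\<^sub>R y) = 0" "v \<in> f ` ?I" "g v \<noteq> 0"
      by (auto simp: dependent_finite)
    then obtain k where k: "k \<in> ?I" "g (f k) \<noteq> 0" by auto
    let ?p = "\<Sum>i\<in>?I. monom (complex_of_real (g (f i))) i"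
    have "coeff ?p k = g (f k)" using k(1) by (simp add: coeff_sum)
    then have p0: "?p \<noteq> 0" using k(2) by (metis coeff_0 of_real_eq_0_iff)
    have "(\<Sum>i\<in>?I. g (f i) *\<^sub>R f i) = 0"
      using g(1) by (simp only: sum.reindex[OF True] o_def)
    then have "mat_poly_apply M ?p x = 0"
      by (simp add: of_real_scale mat_poly_apply_sum mat_poly_apply_monom f_def)
    then show ?thesis using p0 by blast
  qed
  then show thesis using eigenvector_of_annihilating_poly[OF Y _ _ x] that by blast
qed

subsection \<open>Boundedness of the finite-horizon cost\<close>

text \<open>Young's inequality for the mixed term, from nonnegativity of the form at
  \<open>e *\<^sub>R x - y\<close>. Small \<open>e\<close> keeps the weight of \<open>x\<close>
  close to 1, at the expense of \<open>y\<close>.\<close>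

lemma psd_weighted_triangle:
  assumes "psd_mat P" "e > 0"
  shows "(x + y) \<bullet> (P *v (x + y)) \<le> (1 + e) * (x \<bullet> (P *v x)) + (1 + 1 / e) * (y \<bullet> (P *v y))"
proof -
  have sym: "y \<bullet> (P *v x) = x \<bullet> (P *v y)"
    using assms(1) by (metis hermitian_inner inner_commute psd_mat_def)
  have "0 \<le> (e *\<^sub>R x - y) \<bullet> (P *v (e *\<^sub>R x - y))" using assms(1) by (simp add: psd_mat_def)
  also have "\<dots> = e * (e * (x \<bullet> (P *v x)) - 2 * (x \<bullet> (P *v y)) + y \<bullet> (P *v y) / e)"
    using assms(2) sym
    by (simp add: linear_diff[OF linear_complex_matrix] linear_cmul[OF linear_complex_matrix] inner_diff
        algebra_simps)
  finally have "2 * (x \<bullet> (P *v y)) \<le> e * (x \<bullet> (P *v x)) + y \<bullet> (P *v y) / e"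
    using assms(2) by (simp add: zero_le_mult_iff)
  then show ?thesis
    using sym by (simp add: linear_add[OF linear_complex_matrix] inner_add algebra_simps)
qed

lemma form_scale: "(c *s x) \<bullet> (P *v (c *s x)) = (cmod c)\<^sup>2 * (x \<bullet> (P *v x))"
  by (simp add: vector_scalar_commute inner_scale_scale)

text \<open>The set \<open>X\<close> of states with bounded finite-horizon cost is a complex subspace, and \<open>conj (A x + B u) \<in> X\<close>
  implies \<open>x \<in> X\<close>; by \<open>complement_image\<close>, \<open>X\<close> is then invariant under \<open>x \<mapsto> conj (A x)\<close> and contains the range
  of \<open>conj \<circ> B\<close>.  If \<open>X\<close> is proper, its orthogonal complement contains a left eigenvector \<open>w\<close> of
  \<open>M = conj A \<cdot> A\<close>, so \<open>w\<close> is an uncontrollable mode.  Its eigenvalue also has a right eigenvector \<open>v\<close>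
  modulo \<open>X\<close>; were it smaller than 1 in modulus, the cost at \<open>v\<close> would satisfy \<open>V v \<le> C + k * V v\<close>
  with \<open>k < 1\<close> and be bounded after all.\<close>

lemma value_bounded:
  fixes A :: "complex^'n^'n" and B :: "complex^'m^'n" and P :: "nat \<Rightarrow> complex^'n^'n"
  assumes psd: "\<And>N. psd_mat (P N)"
    and mono: "\<And>N x. x \<bullet> (P N *v x) \<le> x \<bullet> (P (Suc N) *v x)"
    and step: "\<And>N x u. x \<bullet> (P (Suc N) *v x) \<le> stage_cost Q R x u
      + antilin_step A B x u \<bullet> (P N *v antilin_step A B x u)"
    and hautus: "\<And>l w. 1 \<le> cmod l \<Longrightarrow> uncontrollable_mode A B l w \<Longrightarrow> w = 0"
  shows "\<exists>c. \<forall>N. x \<bullet> (P N *v x) \<le> c"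
proof -
  define V where "V N x = x \<bullet> (P N *v x)" for N x
  define X where "X = {x. \<exists>c. \<forall>N. V N x \<le> c}"
  define F where "F x = conj_vec (A *v x)" for x
  have V_mono: "V N x \<le> V (Suc N) x" for N x using mono by (simp add: V_def)
  have V_step: "V (Suc N) x \<le> stage_cost Q R x u + V N (conj_vec (A *v x + B *v u))" for N x u
    using step by (simp add: V_def antilin_step_conj)
  have V_scale: "V N (c *s x) = (cmod c)\<^sup>2 * V N x" for N c x by (simp add: V_def form_scale)
  have scale: "c *s x \<in> X" if x: "x \<in> X" for c x
  proof -
    obtain d where d: "\<forall>N. V N x \<le> d" using x by (auto simp: X_def)
    then have "V N (c *s x) \<le> (cmod c)\<^sup>2 * d" for N by (auto simp: V_scale intro: mult_left_mono)
    then show ?thesis by (auto simp: X_def)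
  qed
  have X: "subspace X"
  proof (rule subspaceI)
    show "0 \<in> X" by (auto simp: X_def V_def)
    show "r *\<^sub>R x \<in> X" if "x \<in> X" for r x using scale[OF that] by (metis of_real_scale)
    fix x y assume "x \<in> X" "y \<in> X"
    then obtain c d where cd: "\<forall>N. V N x \<le> c" "\<forall>N. V N y \<le> d" by (auto simp: X_def)
    have "V N (x + y) \<le> 2 * c + 2 * d" for N
      using psd_weighted_triangle[OF psd[of N], of 1 x y] spec[OF cd(1), of N] spec[OF cd(2), of N] by (simp add: V_def)
    then show "x + y \<in> X" by (auto simp: X_def)
  qed
  have into_X: "x \<in> X" if xu: "conj_vec (A *v x + B *v u) \<in> X" for x u
  proof -
    obtain d where d: "\<forall>N. V N (conj_vec (A *v x + B *v u)) \<le> d" using xu by (auto simp: X_def)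
    have "V N x \<le> stage_cost Q R x u + d" for N
      using V_mono[of N x] V_step[of N x u] spec[OF d, of N] by linarith
    then show ?thesis by (auto simp: X_def)
  qed
  have F: "linear F"
    using linear_compose[OF linear_complex_matrix linear_conj_vec] by (simp add: F_def[abs_def] o_def)
  have FX: "F x \<in> X \<Longrightarrow> x \<in> X" for x using into_X[of x 0] by (simp add: F_def)
  have surj: "\<exists>x z. z \<in> X \<and> y = F x + z" for y using complement_image(1)[OF F X] FX by blast
  have invar: "F x \<in> X" if "x \<in> X" for x using complement_image(2)[OF F X] FX that by blast
  have BX: "conj_vec (B *v u) \<in> X" for u
  proof -
    \<comment> \<open>This \<open>x\<close> is a state that the input \<open>u\<close> steers into
      \<open>X\<close>, namely to \<open>- z\<close>. Hence \<open>x\<close> and then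
      \<open>F x\<close> lie in \<open>X\<close>, and the equation leaves no choice for
      \<open>conj_vec (B *v u)\<close>.\<close>
    obtain x z where xz: "z \<in> X" "- conj_vec (B *v u) = F x + z" using surj by blast
    have "- z = F x + conj_vec (B *v u)"
      using arg_cong[OF xz(2), of "\<lambda>v. v + conj_vec (B *v u) - z"] by (simp add: algebra_simps)
    then have "conj_vec (A *v x + B *v u) = - z" by (simp add: conj_vec_add F_def)
    then have "x \<in> X" using into_X xz(1) X by (metis subspace_neg)
    then have "- (F x + z) \<in> X" using invar xz(1) X by (metis subspace_add subspace_neg)
    then show ?thesis by (simp flip: xz(2))
  qed
  define M where "M = A\<^sup># ** A"
  have M: "M *v x = F (F x)" for x
    by (simp add: M_def F_def conj_mat_vec conj_vec_conj conj_mat_conj flip: matrix_vector_mul_assoc)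
  have MH: "M\<^sup>H *v w = A\<^sup>H *v (transpose A *v w)" for w
    by (simp add: M_def adj_mat_mult adj_mat_conj conj_mat_adj flip: matrix_vector_mul_assoc)
  define Y where "Y = {y. \<forall>x\<in>X. orthogonal x y}"
  have "x \<in> X"
  proof (rule ccontr)
    assume "x \<notin> X"
    then have "span X \<noteq> UNIV" using X by (metis UNIV_I span_eq_iff)
    then have "dim X < DIM(complex^'n)" using dim_eq_full[of X] dim_subset_UNIV[of X] by linarith
    then obtain w0 where "w0 \<noteq> 0" "\<And>y. y \<in> span X \<Longrightarrow> orthogonal w0 y"
      using orthogonal_to_subspace_exists by blast
    then have w0: "w0 \<in> Y" "w0 \<noteq> 0" by (auto simp: Y_def span_base orthogonal_commute)
    have Y: "subspace Y" unfolding Y_def by (rule subspace_orthogonal_to_vectors)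
    have Y_scale: "c *s y \<in> Y" if "y \<in> Y" for c y
    proof -
      have "x \<bullet> (c *s y) = 0" if "x \<in> X" for x
        using \<open>y \<in> Y\<close> scale[OF that, of "cnj c"] inner_scale_left[of "cnj c" x y]
        by (simp add: Y_def orthogonal_def)
      then show ?thesis by (simp add: Y_def orthogonal_def)
    qed
    have Y_inv: "M\<^sup>H *v y \<in> Y" if "y \<in> Y" for y
      using that invar by (auto simp: Y_def orthogonal_def adj_mat_inner_right M)
    obtain l w where w: "w \<in> Y" "w \<noteq> 0" "M\<^sup>H *v w = l *s w"
      using invariant_subspace_eigenvector[OF Y Y_scale Y_inv w0] by blast
    have wX: "z \<bullet> w = 0" if "z \<in> X" for z using w(1) that by (simp add: Y_def orthogonal_def)
    define G where "G x = M *v x - cnj l *s x" for x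
    have G: "linear G"
      by (rule linearI) (simp_all add: G_def linear_add[OF linear_complex_matrix] vec.scale_right_distrib
          linear_cmul[OF linear_complex_matrix] vec_eq_iff algebra_simps)
    have Gw: "G x \<bullet> w = 0" for x
      using w(3) inner_scale_left[of "cnj l" x w]
      by (simp add: G_def inner_diff flip: adj_mat_inner_right)
    \<comment> \<open>Otherwise \<open>complement_image\<close> writes \<open>w\<close> as a sum
      from the range of \<open>G\<close> and \<open>X\<close>, both orthogonal to \<open>w\<close>,
      which forces \<open>w = 0\<close>.\<close>
    have "\<exists>v. v \<notin> X \<and> G v \<in> X"
    proof (rule ccontr)
      assume "\<not> ?thesis"
      then obtain x z where "z \<in> X" "w = G x + z" using complement_image(1)[OF G X] by metis
      then have "w \<bullet> w = 0" using Gw wX by (metis add.right_neutral inner_add_left)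
      then show False using w(2) by simp
    qed
    then obtain v where v: "v \<notin> X" "G v \<in> X" by blast
    obtain D where D: "\<forall>N. V N (G v) \<le> D" using v(2) by (auto simp: X_def)
    have "1 \<le> cmod l"
    proof (rule ccontr)
      assume l1: "\<not> 1 \<le> cmod l"
      define t where "t = (cmod l)\<^sup>2"
      \<comment> \<open>With this choice \<open>1 - (1 + e) * t = (1 - t) * (2 - t) / 2\<close>,
        which is positive for \<open>t < 1\<close>.\<close>
      define e where "e = (1 - t) / 2"
      have t: "0 \<le> t" "t < 1" using l1 by (auto simp: t_def power_less_one_iff abs_square_less_1)
      have e: "e > 0" using t by (simp add: e_def)
      define k where "k = (1 + e) * t"
      have "0 < (1 - t) * (2 - t)" using t by (intro mult_pos_pos) auto
      then have k: "k < 1" by (simp add: k_def e_def field_simps)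
      define C where "C = stage_cost Q R v 0 + stage_cost Q R (F v) 0 + (1 + 1 / e) * D"
      have "V N v \<le> C / (1 - k)" for N
      proof -
        \<comment> \<open>Two steps with zero input lead from \<open>v\<close> to
          \<open>cnj l *s v\<close> plus a vector of bounded cost; the conjugate appears because
          \<open>l\<close> belongs to the adjoint of \<open>M\<close>.\<close>
        have Mv: "F (F v) = cnj l *s v + G v" by (simp add: G_def M)
        have "V N v \<le> V (Suc (Suc N)) v" using V_mono order_trans by blast
        also have "\<dots> \<le> stage_cost Q R v 0 + (stage_cost Q R (F v) 0 + V N (F (F v)))"
          using V_step[of "Suc N" v 0] V_step[of N "F v" 0] by (simp add: F_def)
        also have "V N (F (F v)) \<le> (1 + e) * V N (cnj l *s v) + (1 + 1 / e) * V N (G v)"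
          unfolding Mv V_def by (rule psd_weighted_triangle[OF psd e])
        also have "(1 + 1 / e) * V N (G v) \<le> (1 + 1 / e) * D" using e by (intro mult_left_mono D[rule_format]) auto
        finally have "V N v \<le> C + k * V N v" by (simp add: C_def k_def t_def V_scale mult.assoc)
        then show ?thesis using k by (simp add: field_simps)
      qed
      then show False using v(1) by (auto simp: X_def)
    qed
    moreover have "uncontrollable_mode A B l w"
    proof -
      have "(transpose B *v w) \<bullet> z = 0" for z
      proof -
        have "transpose B *v w = (B\<^sup>#)\<^sup>H *v w" by (simp add: adj_mat_conj conj_mat_adj)
        then have "(transpose B *v w) \<bullet> z = (B\<^sup># *v z) \<bullet> w" by (simp add: adj_mat_inner) (rule inner_commute)
        then show ?thesis using wX[OF BX[of "conj_vec z"]] by (simp add: conj_mat_vec conj_vec_conj)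
      qed
      moreover have "(B\<^sup>H *v (transpose A *v w)) \<bullet> z = 0" for z
      proof -
        have "transpose A *v w = (A\<^sup>#)\<^sup>H *v w" by (simp add: adj_mat_conj conj_mat_adj)
        then have "(B\<^sup>H *v (transpose A *v w)) \<bullet> z = (A\<^sup># *v (B *v z)) \<bullet> w"
          by (simp add: adj_mat_inner) (rule inner_commute)
        then show ?thesis using wX[OF invar[OF BX[of z]]] by (simp add: F_def conj_mat_vec conj_vec_conj conj_mat_conj)
      qed
      ultimately show ?thesis using w(3) unfolding uncontrollable_mode_def MH by (metis inner_eq_zero_iff)
    qed
    ultimately show False using hautus w(2) by blast
  qed
  then show ?thesis by (auto simp: X_def V_def)
qed

subsection \<open>Convergence of the Riccati iteration\<close>

lemma pos_def_mat_hermitian: "pos_def_mat P \<Longrightarrow> P\<^sup>H = P"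
  by (simp add: pos_def_mat_def)

lemma psd_mat_hermitian: "psd_mat P \<Longrightarrow> P\<^sup>H = P"
  by (simp add: psd_mat_def)

lemma psd_mat_nonneg: "psd_mat P \<Longrightarrow> 0 \<le> x \<bullet> (P *v x)"
  by (simp add: psd_mat_def)

lemma pos_def_inverse_hermitian:
  assumes "pos_def_mat S"
  shows "(matrix_inv S)\<^sup>H = matrix_inv S"
proof -
  note inv = pos_def_mat_inverse[OF assms]
  have "(S ** matrix_inv S)\<^sup>H = (mat 1)\<^sup>H" using inv by simp
  then have "(matrix_inv S)\<^sup>H ** S = mat 1"
    by (simp add: adj_mat_mult pos_def_mat_hermitian[OF assms])
      (simp add: adj_mat_def vec_eq_iff transpose_def mat_def)
  then have "(matrix_inv S)\<^sup>H ** (S ** matrix_inv S) = matrix_inv S" by (simp add: matrix_mul_assoc)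
  then show ?thesis using inv by simp
qed

lemma riccati_map_psd:
  assumes "psd_mat P" "pos_def_mat Q" "pos_def_mat R"
  shows "psd_mat (riccati_map A B Q R P)"
proof (rule psd_matI)
  have [simp]: "(P\<^sup>#)\<^sup>H = P\<^sup>#" "Q\<^sup>H = Q"
    using psd_mat_conj[OF assms(1)] assms(2) by (simp_all add: psd_mat_def pos_def_mat_def)
  show "(riccati_map A B Q R P)\<^sup>H = riccati_map A B Q R P"
    using pos_def_inverse_hermitian[OF control_weight_pos_def[OF assms(1,3), of B]]
    by (simp add: riccati_map_def adj_mat_add adj_mat_diff adj_mat_mult adj_mat_adj matrix_mul_assoc)
  fix x
  \<comment> \<open>At the optimal input the penalty vanishes, leaving a sum of nonnegative
    costs.\<close>
  show "0 \<le> x \<bullet> (riccati_map A B Q R P *v x)"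
    using riccati_square[OF assms(1,3), of Q x "anti_gain A B R P *v x" A B]
      stage_cost_nonneg[OF assms(2,3), of x "anti_gain A B R P *v x"]
      psd_mat_nonneg[OF assms(1), of "antilin_step A B x (anti_gain A B R P *v x)"] by simp
qed

primrec riccati_iter where
  "riccati_iter A B Q R 0 = 0"
| "riccati_iter A B Q R (Suc N) = riccati_map A B Q R (riccati_iter A B Q R N)"

lemma riccati_iter_psd:
  assumes "pos_def_mat Q" "pos_def_mat R"
  shows "psd_mat (riccati_iter A B Q R N)"
  by (induction N) (auto simp: riccati_map_psd assms intro!: psd_matI adj_mat_zero)

lemma riccati_iter_step:
  assumes "pos_def_mat Q" "pos_def_mat R"
  shows "x \<bullet> (riccati_iter A B Q R (Suc N) *v x) \<le> stage_cost Q R x u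
    + antilin_step A B x u \<bullet> (riccati_iter A B Q R N *v antilin_step A B x u)"
  using riccati_square[OF riccati_iter_psd[OF assms] assms(2), of Q x u A B A B N]
    pos_def_mat_nonneg[OF control_weight_pos_def[OF riccati_iter_psd[OF assms] assms(2), of B A B N]]
  by simp

text \<open>Both horizons are compared at the input \<open>?u\<close> that is optimal for the longer
  one: the induction hypothesis handles the next state, and \<open>?u\<close> is merely admissible
  for the shorter horizon.\<close>

lemma riccati_iter_mono:
  assumes "pos_def_mat Q" "pos_def_mat R"
  shows "x \<bullet> (riccati_iter A B Q R N *v x) \<le> x \<bullet> (riccati_iter A B Q R (Suc N) *v x)"
proof (induction N arbitrary: x)
  case 0
  then show ?case using psd_mat_nonneg[OF riccati_iter_psd[OF assms], of x A B 1] by simp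
next
  case (Suc N)
  let ?P = "riccati_iter A B Q R" and ?u = "anti_gain A B R (riccati_iter A B Q R (Suc N)) *v x"
  have "x \<bullet> (?P (Suc (Suc N)) *v x)
      = stage_cost Q R x ?u + antilin_step A B x ?u \<bullet> (?P (Suc N) *v antilin_step A B x ?u)"
    using riccati_square[OF riccati_iter_psd[OF assms] assms(2), of Q x ?u A B A B "Suc N"] by simp
  then show ?case using riccati_iter_step[OF assms, of x A B N ?u] Suc.IH[of "antilin_step A B x ?u"]
    by linarith
qed

lemma tendsto_matrix_vector:
  fixes P :: "'a \<Rightarrow> complex^'n^'m"
  assumes "(P \<longlongrightarrow> P') F" "(x \<longlongrightarrow> x') F"
  shows "((\<lambda>N. P N *v x N) \<longlongrightarrow> P' *v x') F"
  by (rule vec_tendstoI) (auto simp: matrix_vector_mult_def intro!: tendsto_intros assms)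

lemma tendsto_conj_mat:
  assumes "(P \<longlongrightarrow> P') F"
  shows "((\<lambda>N. (P N)\<^sup>#) \<longlongrightarrow> P'\<^sup>#) F"
  by (intro vec_tendstoI) (auto intro!: tendsto_intros assms)

text \<open>Bounded monotone diagonal values converge, polarization carries this to all mixed
  values, and pairing with \<open>axis i 1\<close> and \<open>axis i \<i>\<close> extracts real and
  imaginary parts of the entries.\<close>

lemma incseq_forms_convergent:
  fixes P :: "nat \<Rightarrow> complex^'n^'n"
  assumes herm: "\<And>N. (P N)\<^sup>H = P N"
    and mono: "\<And>N x. x \<bullet> (P N *v x) \<le> x \<bullet> (P (Suc N) *v x)"
    and bound: "\<And>x. \<exists>c. \<forall>N. x \<bullet> (P N *v x) \<le> c"
  obtains P' where "P \<longlonglongrightarrow> P'"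
proof -
  have conv: "convergent (\<lambda>N. x \<bullet> (P N *v x))" for x
  proof -
    obtain c where "\<And>N. x \<bullet> (P N *v x) \<le> c" using bound by blast
    moreover have inc: "incseq (\<lambda>N. x \<bullet> (P N *v x))" using mono by (intro incseq_SucI)
    ultimately show ?thesis using incseq_convergent by (metis convergent_def)
  qed
  have conv2: "convergent (\<lambda>N. x \<bullet> (P N *v y))" for x y
  proof -
    have "x \<bullet> (P N *v y)
        = ((x + y) \<bullet> (P N *v (x + y)) - x \<bullet> (P N *v x) - y \<bullet> (P N *v y)) * (1 / 2)" for N
      using sym_form_polarization[OF linear_complex_matrix hermitian_inner[OF herm[of N]], of x y] by simp
    then show ?thesis by (simp only:) (intro convergent_mult convergent_diff conv convergent_const)
  qed
  have entry: "P N $ i $ j = Complex (axis i 1 \<bullet> (P N *v axis j 1)) (axis i \<i> \<bullet> (P N *v axis j 1))" for N i j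
    by (simp add: inner_axis' matrix_vector_mult_axis inner_complex_def complex_eq_iff)
  have "\<exists>z. (\<lambda>N. P N $ i $ j) \<longlonglongrightarrow> z" for i j
    unfolding entry
    using conv2[of "axis i 1" "axis j 1"] conv2[of "axis i \<i>" "axis j 1"]
    by (auto simp: convergent_def intro: tendsto_Complex)
  then obtain z where "(\<lambda>N. P N $ i $ j) \<longlonglongrightarrow> z i j" for i j by metis
  then have "P \<longlonglongrightarrow> (\<chi> i j. z i j)" by (intro vec_tendstoI) simp
  then show thesis by (rule that)
qed

text \<open>Passing to the limit in the recursion is done without limits of inverse matrices. The
  input \<open>k\<close> optimal for the limit \<open>P\<close> is kept fixed in
  \<open>riccati_square\<close> for each iterate, and its penalty there is shown to vanish.\<close>

lemma riccati_solution_exists: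
  assumes Q: "pos_def_mat Q" and R: "pos_def_mat R"
    and hautus: "\<And>l w. 1 \<le> cmod l \<Longrightarrow> uncontrollable_mode A B l w \<Longrightarrow> w = 0"
  obtains P where "pos_def_mat P" "anti_riccati A B Q R P"
proof -
  let ?P = "riccati_iter A B Q R"
  note psd = riccati_iter_psd[OF Q R] and mono = riccati_iter_mono[OF Q R]
  have "\<exists>c. \<forall>N. x \<bullet> (?P N *v x) \<le> c" for x
    by (rule value_bounded[where P = ?P and A = A and B = B, OF psd mono riccati_iter_step[OF Q R] hautus])
  then obtain P where P: "?P \<longlonglongrightarrow> P"
    using incseq_forms_convergent[where P = ?P, OF psd_mat_hermitian[OF psd] mono] by metis
  note form_lim = tendsto_inner[OF tendsto_const tendsto_matrix_vector[OF P tendsto_const]]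
  have herm: "P\<^sup>H = P"
  proof -
    have "(\<lambda>N. (?P N)\<^sup>H) \<longlonglongrightarrow> P\<^sup>H"
      unfolding adj_mat_def transpose_def
      by (intro vec_tendstoI) (auto intro!: tendsto_intros P)
    then show ?thesis using P LIMSEQ_unique by (simp add: psd_mat_hermitian[OF psd])
  qed
  have psdP: "psd_mat P"
    using herm by (rule psd_matI) (auto intro!: LIMSEQ_le_const[OF form_lim] psd_mat_nonneg[OF psd])
  have "pos_def_mat P"
    unfolding pos_def_mat_def
  proof (intro conjI allI impI)
    fix x :: "complex^'a" assume "x \<noteq> 0"
    \<comment> \<open>This bound starts at the iterate 1, because the iterate 0 is the zero
      matrix.\<close>
    have "x \<bullet> (Q *v x) \<le> x \<bullet> (?P (Suc N) *v x)" for N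
      using riccati_square[OF psd R, of Q x "anti_gain A B R (?P N) *v x" A B A B N]
        pos_def_mat_nonneg[OF R, of "anti_gain A B R (?P N) *v x"]
        psd_mat_nonneg[OF psd, of "antilin_step A B x (anti_gain A B R (?P N) *v x)" A B N]
      by (simp add: stage_cost_def)
    then have "x \<bullet> (Q *v x) \<le> x \<bullet> (P *v x)"
      by (intro LIMSEQ_le_const[OF LIMSEQ_Suc[OF form_lim]]) auto
    moreover have "0 < x \<bullet> (Q *v x)" using Q \<open>x \<noteq> 0\<close> by (simp add: pos_def_mat_def Re_cdot)
    ultimately show "0 < Re (cdot x (P *v x))" by (simp add: Re_cdot)
  qed (rule herm)
  moreover have "riccati_map A B Q R P = P"
  proof -
    obtain r where r: "r > 0" "\<And>z. r * (norm z)\<^sup>2 \<le> z \<bullet> (R *v z)" using pos_def_mat_bound[OF R] by blast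
    have "x \<bullet> (riccati_map A B Q R P *v x) = x \<bullet> (P *v x)" for x
    proof -
      let ?S = "\<lambda>N. control_weight B R (?P N)"
      define k where "k = anti_gain A B R P *v x"
      define y where "y = antilin_step A B x k"
      define z where "z N = k - anti_gain A B R (?P N) *v x" for N
      have S: "control_weight B R P' *v u = R *v u + B\<^sup>H *v (P'\<^sup># *v (B *v u))" for P' u
        by (simp add: control_weight_def matrix_vector_mult_add_rdistrib flip: matrix_vector_mul_assoc)
      \<comment> \<open>\<open>?S N *v z N\<close> is the residual of \<open>k\<close> in the
        first-order condition for the iterate \<open>N\<close>. It contains no inverse, so it
        converges to the residual for \<open>P\<close>, which is 0.\<close>
      have Sz: "?S N *v z N = R *v k + B\<^sup>H *v ((?P N)\<^sup># *v (B *v k)) + B\<^sup>H *v ((?P N)\<^sup># *v (A *v x))" for N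
        by (simp add: z_def linear_diff[OF linear_complex_matrix] anti_gain_eq[OF psd R])
          (simp add: S)
      have "(\<lambda>N. ?S N *v z N) \<longlonglongrightarrow> R *v k + B\<^sup>H *v (P\<^sup># *v (B *v k)) + B\<^sup>H *v (P\<^sup># *v (A *v x))"
        unfolding Sz by (intro tendsto_intros tendsto_matrix_vector tendsto_conj_mat P)
      also have "R *v k + B\<^sup>H *v (P\<^sup># *v (B *v k)) + B\<^sup>H *v (P\<^sup># *v (A *v x)) = 0"
        unfolding S[symmetric] k_def by (simp add: anti_gain_eq[OF psdP R])
      finally have Sz0: "(\<lambda>N. ?S N *v z N) \<longlonglongrightarrow> 0" .
      \<comment> \<open>Since \<open>?S N\<close> dominates \<open>R\<close>, the constant
        \<open>r\<close> is a lower bound for it uniform in \<open>N\<close>; this converts a small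
        residual into a small penalty.\<close>
      have z_le: "z N \<bullet> (?S N *v z N) \<le> (norm (?S N *v z N))\<^sup>2 / r" for N
      proof -
        have "r * (norm (z N))\<^sup>2 \<le> z N \<bullet> (?S N *v z N)"
          using r(2)[of "z N"] psd_mat_nonneg[OF psd_mat_conj[OF psd], of "B *v z N" A B N]
          by (simp add: control_weight_inner)
        also have "\<dots> \<le> norm (z N) * norm (?S N *v z N)" by (rule norm_cauchy_schwarz)
        finally have 1: "r * norm (z N) \<le> norm (?S N *v z N)"
          by (cases "z N = 0") (simp_all add: power2_eq_square)
        have "r * (z N \<bullet> (?S N *v z N)) \<le> r * (norm (z N) * norm (?S N *v z N))"
          using r(1) by (intro mult_left_mono norm_cauchy_schwarz) simp
        also have "\<dots> \<le> norm (?S N *v z N) * norm (?S N *v z N)"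
          using mult_right_mono[OF 1] by (simp add: mult.assoc)
        finally show ?thesis using r(1) by (simp add: pos_le_divide_eq power2_eq_square mult.commute)
      qed
      have "(\<lambda>N. (norm (?S N *v z N))\<^sup>2 / r) \<longlonglongrightarrow> (norm (0::complex^'b))\<^sup>2 / r"
        using r(1) by (intro tendsto_intros Sz0) simp
      then have zS: "(\<lambda>N. z N \<bullet> (?S N *v z N)) \<longlonglongrightarrow> 0"
        by - (rule tendsto_zero_squeeze[OF _ _ z_le],
          simp_all add: pos_def_mat_nonneg[OF control_weight_pos_def[OF psd R]])
      have "stage_cost Q R x k + y \<bullet> (?P N *v y) = x \<bullet> (?P (Suc N) *v x) + z N \<bullet> (?S N *v z N)" for N
        using riccati_square[OF psd R, of Q x k A B A B N] by (simp add: y_def z_def)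
      moreover have "(\<lambda>N. stage_cost Q R x k + y \<bullet> (?P N *v y)) \<longlonglongrightarrow> stage_cost Q R x k + y \<bullet> (P *v y)"
        by (intro tendsto_intros form_lim)
      moreover have "(\<lambda>N. x \<bullet> (?P (Suc N) *v x) + z N \<bullet> (?S N *v z N)) \<longlonglongrightarrow> x \<bullet> (P *v x) + 0"
        by (intro tendsto_add zS LIMSEQ_Suc[OF form_lim])
      ultimately have "stage_cost Q R x k + y \<bullet> (P *v y) = x \<bullet> (P *v x) + 0"
        using LIMSEQ_unique by (simp only:)
      then show ?thesis using riccati_square[OF psdP R, of Q x k A B] by (simp add: k_def y_def)
    qed
    then have "riccati_map A B Q R P *v x = P *v x" for x
      by (intro sym_form_unique[OF linear_complex_matrix _ linear_complex_matrix])
        (simp_all add: hermitian_inner herm psd_mat_hermitian[OF riccati_map_psd[OF psdP Q R]])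
    then show ?thesis by (simp add: matrix_eq)
  qed
  ultimately show thesis using that by (simp add: anti_riccati_iff)
qed

section \<open>Assembling the equivalences\<close>

lemma stabilizable_imp_hautus:
  assumes "stabilizable A B" "1 \<le> cmod l" "uncontrollable_mode A B l w"
  shows "w = 0"
proof -
  obtain K1 K2 where K: "asymptotically_stable (\<lambda>x. antilin_step A B x (bimat_apply (K1, K2) x))"
    using assms(1) by (auto simp: stabilizable_def)
  let ?f = "\<lambda>x. antilin_step A B x (bimat_apply (K1, K2) x)"
  show ?thesis
  proof (rule hautus_necessary[OF _ assms(3,2)])
    fix x0
    show "\<exists>x u. x 0 = x0 \<and> (\<forall>k::nat. x (Suc k) = antilin_step A B (x k) (u k)) \<and> x \<longlonglongrightarrow> 0"
      using K by (intro exI[of _ "\<lambda>k. (?f ^^ k) x0"] exI[of _ "\<lambda>k. bimat_apply (K1, K2) ((?f ^^ k) x0)"])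
        (simp add: asymptotically_stable_def)
  qed
qed

lemma solvable_imp_hautus:
  assumes "pos_def_mat Q" "pos_def_mat R" "lqr_solvable A B Q R" "1 \<le> cmod l" "uncontrollable_mode A B l w"
  shows "w = 0"
proof (rule hautus_necessary[OF _ assms(5,4)])
  fix x0
  obtain u where "lqr_cost A B Q R x0 u \<noteq> \<infinity>"
    using assms(3) unfolding lqr_solvable_def by (metis abs_ereal.simps(3))
  then have "trajectory A B x0 u \<longlonglongrightarrow> 0" by (rule lqr_cost_finiteD(2)[OF assms(1,2)])
  then show "\<exists>x u. x 0 = x0 \<and> (\<forall>k::nat. x (Suc k) = antilin_step A B (x k) (u k)) \<and> x \<longlonglongrightarrow> 0"
    by (intro exI[of _ "trajectory A B x0 u"] exI[of _ u]) simp
qed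

lemma riccati_imp_stabilizable:
  assumes "pos_def_mat Q" "pos_def_mat R" "pos_def_mat P" "anti_riccati A B Q R P"
  shows "stabilizable A B"
proof -
  obtain b where "value_function A B Q R (\<lambda>x. x \<bullet> (P *v x))
    (\<lambda>z. z \<bullet> (control_weight B R P *v z)) ((*v) (anti_gain A B R P)) b"
    using anti_riccati_value assms by blast
  then have "asymptotically_stable (\<lambda>x. antilin_step A B x (bimat_apply (anti_gain A B R P, 0) x))"
    unfolding bimat_apply_fst by (rule value_function.closed_loop_stable)
  then show ?thesis unfolding stabilizable_def by blast
qed

text \<open>All equivalences pass through the modal condition \<open>hautus\<close>: solvability and
  stabilizability each imply it, it produces a Riccati solution, and a solution gives back
  both.\<close>

theorem theorem2:
  fixes A2 :: "complex^'n^'n" and B2 :: "complex^'m^'n"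
    and Q :: "complex^'n^'n" and R :: "complex^'m^'m"
  assumes "pos_def_mat Q" and "pos_def_mat R"
  shows
    "(lqr_solvable A2 B2 Q R \<longleftrightarrow> stabilizable A2 B2) \<and>
     (stabilizable A2 B2 \<longleftrightarrow>
        (\<forall>l::complex. 1 \<le> cmod l \<longrightarrow>
           rank (block_row3 (mat l - A2 ** A2\<^sup>#) B2 (A2 ** B2\<^sup>#)) = CARD('n))) \<and>
     (stabilizable A2 B2 \<longleftrightarrow> (\<exists>!P. pos_def_mat P \<and> anti_riccati A2 B2 Q R P)) \<and>
     (lqr_solvable A2 B2 Q R \<longrightarrow>
        (\<exists>!P12. pos_def_bimat P12 \<and> bimat_riccati A2 B2 Q R P12) \<and>
        (\<forall>PA. pos_def_mat PA \<and> anti_riccati A2 B2 Q R PA \<longrightarrow>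
           (\<forall>P12. pos_def_bimat P12 \<and> bimat_riccati A2 B2 Q R P12 \<longrightarrow> P12 = (PA, 0)) \<and>
           (let K = anti_gain A2 B2 R PA in
              asymptotically_stable (\<lambda>x. antilin_step A2 B2 x (K *v x)) \<and>
              (\<forall>x0. (\<forall>u. lqr_optimal A2 B2 Q R x0 u \<longleftrightarrow>
                           (\<forall>k. u k = K *v trajectory A2 B2 x0 u k)) \<and>
                    (INF u. lqr_cost A2 B2 Q R x0 u) = ereal (Re (cdot x0 (PA *v x0)))))))"
proof -
  define hautus where "hautus \<longleftrightarrow> (\<forall>l. 1 \<le> cmod l \<longrightarrow> (\<forall>w. uncontrollable_mode A2 B2 l w \<longrightarrow> w = 0))"
  define sol where "sol P \<longleftrightarrow> pos_def_mat P \<and> anti_riccati A2 B2 Q R P" for P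
  define bsol where "bsol P \<longleftrightarrow> pos_def_bimat P \<and> bimat_riccati A2 B2 Q R P" for P
  have hautus_rank: "(\<forall>l::complex. 1 \<le> cmod l \<longrightarrow>
      rank (block_row3 (mat l - A2 ** A2\<^sup>#) B2 (A2 ** B2\<^sup>#)) = CARD('n)) \<longleftrightarrow> hautus"
    unfolding hautus_rank_iff hautus_def ..
  have ex: "\<exists>P. sol P" if hautus
    using riccati_solution_exists[OF assms, of A2 B2] that unfolding hautus_def sol_def by metis
  have bimat: "bsol (P, 0)" if "sol P" for P
    using that assms unfolding sol_def bsol_def by (simp add: pos_def_bimat_fst anti_riccati_imp_bimat)
  have uniq: "P12 = (P, 0)" if "sol P" "bsol P12" for P P12
    using that riccati_solution_unique[OF assms] unfolding sol_def bsol_def by blast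
  have val: "\<exists>b. value_function A2 B2 Q R (\<lambda>x. x \<bullet> (P *v x))
      (\<lambda>z. z \<bullet> (control_weight B2 R P *v z)) ((*v) (anti_gain A2 B2 R P)) b" if "sol P" for P
    using anti_riccati_value[OF assms] that unfolding sol_def by metis
  have stab: "stabilizable A2 B2" if "sol P" for P
    using riccati_imp_stabilizable[OF assms] that unfolding sol_def by blast
  have solv: "lqr_solvable A2 B2 Q R" if "sol P" for P
    using val[OF that] value_function.solvable by blast
  have stab_iff: "stabilizable A2 B2 \<longleftrightarrow> hautus"
    using stabilizable_imp_hautus ex stab unfolding hautus_def by metis
  have solv_iff: "lqr_solvable A2 B2 Q R \<longleftrightarrow> hautus"
    using solvable_imp_hautus[OF assms] ex solv unfolding hautus_def by metis
  \<comment> \<open>For uniqueness, a second solution \<open>P'\<close> is embedded as the bimatrix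
    solution \<open>(P', 0)\<close>, which \<open>uniq\<close> identifies with
    \<open>(P, 0)\<close>.\<close>
  have ex1: "(\<exists>!P. sol P) \<longleftrightarrow> hautus"
    using ex stab stab_iff uniq bimat by (metis prod.inject)
  have bex1: "\<exists>!P12. bsol P12" if hautus
    using ex[OF that] uniq bimat by metis
  show ?thesis
    unfolding stab_iff solv_iff hautus_rank sol_def[symmetric] bsol_def[symmetric] ex1
  \<comment> \<open>The equivalences have become \<open>hautus \<longleftrightarrow> hautus\<close>;
    what remains is the unique bimatrix solution, its relation to \<open>PA\<close>, and the
    properties of the optimal feedback.\<close>
  proof (intro conjI impI allI refl, goal_cases)
    case 1
    then show ?case by (rule bex1)
  next
    case (2 P P12)
    then show ?case by (intro uniq)
  next
    case (3 P)
    then obtain b where v: "value_function A2 B2 Q R (\<lambda>x. x \<bullet> (P *v x))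
      (\<lambda>z. z \<bullet> (control_weight B2 R P *v z)) ((*v) (anti_gain A2 B2 R P)) b"
      using val by blast
    show ?case
      using value_function.closed_loop_stable[OF v] value_function.optimal_iff[OF v]
        value_function.optimal_cost[OF v] unfolding Let_def Re_cdot by blast
  qed
qed

end
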